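(* Let $(T,\mathcal{B},\mu)=(\mathbb{R}_+,\mathcal{B}(\mathbb{R}_+),\mathrm{d}x)$ be the positive half-line with Lebesgue measure, $\mathfrak{h}=L^2(\mathbb{R}_+)$, and let $X=(X^1,X^2)\in\mathrm{Dom}\,\delta$. Then $$\int_{\mathbb{R}_+}X^1(t)\,\mathrm{d}P(t)+\int_{\mathbb{R}_+}X^2(t)\,\mathrm{d}Q(t)=\int^{\rm BL}_{\mathbb{R}_+}\big(X^2(t)-iX^1(t)\big)\,\mathrm{d}A^*_t+\int^{\rm BL}_{\mathbb{R}_+}\big(X^2(t)+iX^1(t)\big)\,\mathrm{d}A_t,$$ where the left-hand side denotes the Hitsuda–Skorohod integral $\delta(X)$ and the integrals on the right are the non-causal quantum stochastic integrals of Belavkin and Lindsay.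
   Context: $\mathfrak{H}=\Gamma_s(L^2(\mathbb{R}_+;\mathbb{C}))$ is the symmetric Fock space, with exponential vectors $\mathcal{E}(k)=\sum_nk^{\otimes n}/\sqrt{n!}$, inner products linear in the second argument. $L^2(\mathbb{R}_+,\mathcal{B}(\mathfrak{H}))$ denotes the $\mathcal{B}(\mathfrak{H})$-valued measurable functions $F$ on $\mathbb{R}_+$ with $\int\|F_t\|^2\mathrm{d}t<\infty$. Divergence operator: $\mathrm{Dom}\,\delta$ is the set of $X=(X^1,X^2)\in L^2(\mathbb{R}_+,\mathcal{B}(\mathfrak{H}))\oplus L^2(\mathbb{R}_+,\mathcal{B}(\mathfrak{H}))$ for which there is $M\in\mathcal{B}(\mathfrak{H})$ such that for all $k_1,k_2\in L^2(\mathbb{R}_+;\mathbb{C})$ $$\langle\mathcal{E}(k_1),M\mathcal{E}(k_2)\rangle=\int_{\mathbb{R}_+}\Big(i\big(k_2(t)-\overline{k_1(t)}\big)\langle\mathcal{E}(k_1),X^1(t)\mathcal{E}(k_2)\rangle+\big(\overline{k_1(t)}+k_2(t)\big)\langle\mathcal{E}(k_1),X^2(t)\mathcal{E}(k_2)\rangle\Big)\mathrm{d}t;$$ $\delta(X):=M$ is also written $\int X^1(t)\mathrm{d}P(t)+\int X^2(t)\mathrm{d}Q(t)$. Belavkin–Lindsay integrals: let $\tilde D$ be the closed (Malliavin) gradient from $\mathfrak{H}$ to $\mathfrak{H}\otimes L^2(\mathbb{R}_+;\mathbb{C})\cong L^2(\mathbb{R}_+;\mathfrak{H})$ determined by $\tilde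 D\mathcal{E}(k)=\mathcal{E}(k)\otimes k$ (so $(\tilde D\mathcal{E}(k))_t=k(t)\mathcal{E}(k)$), and $\tilde\delta=\tilde D^*$ its adjoint. For $F\in L^2(\mathbb{R}_+,\mathcal{B}(\mathfrak{H}))$ and a vector $\psi$, the annihilation integral is the Bochner integral $\int^{\rm BL}F_t\,\mathrm{d}A_t\,\psi=\int F_t(\tilde D\psi)_t\,\mathrm{d}t$ and the creation integral is $\int^{\rm BL}F_t\,\mathrm{d}A^*_t\,\psi=\tilde\delta(F_\cdot\psi)$ (when $F_\cdot\psi\in\mathrm{Dom}\,\tilde\delta$). The identity in the claim is an identity of operators on the linear span of the exponential vectors. *)

theory Defs
  imports "HOL-Analysis.Analysis"
begin

definition square_integrable :: "'a measure \<Rightarrow> ('a \<Rightarrow> 'b::real_normed_vector) \<Rightarrow> bool" where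
  "square_integrable M f \<longleftrightarrow> f \<in> borel_measurable M \<and> integrable M (\<lambda>x. (norm (f x))\<^sup>2)"

definition half_line :: "real measure" where
  "half_line = restrict_space lborel {0..}"

abbreviation power_space :: "nat \<Rightarrow> (nat \<Rightarrow> real) measure" where
  "power_space n \<equiv> Pi\<^sub>M {..<n} (\<lambda>_. half_line)"

text \<open>
  The $n$-fold symmetric tensor power of \<open>L\<^sup>2(\<real>\<^sub>+; \<complex>)\<close> is realised as the space of square-integrable
  functions on \<open>(\<real>\<^sub>+)\<^sup>n\<close> that are almost everywhere invariant under permutation of the coordinates,
  with the inner product of the full tensor power (no factor \<open>n!\<close>). A Fock space vector is
  represented by the sequence of its components; points of \<open>(\<real>\<^sub>+)\<^sup>n\<close> are extensional functions
  on \<open>{..<n}\<close>.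
\<close>

definition fock_seq :: "(nat \<Rightarrow> (nat \<Rightarrow> real) \<Rightarrow> complex) \<Rightarrow> bool" where
  "fock_seq f \<longleftrightarrow>
     (\<forall>n. square_integrable (power_space n) (f n)) \<and>
     (\<forall>n p. p permutes {..<n} \<longrightarrow> (AE x in power_space n. f n (x \<circ> p) = f n x)) \<and>
     summable (\<lambda>n. \<integral>x. (cmod (f n x))\<^sup>2 \<partial>power_space n)"

definition fock_eq :: "(nat \<Rightarrow> (nat \<Rightarrow> real) \<Rightarrow> complex) \<Rightarrow> (nat \<Rightarrow> (nat \<Rightarrow> real) \<Rightarrow> complex) \<Rightarrow> bool" where
  "fock_eq f g \<longleftrightarrow> fock_seq f \<and> fock_seq g \<and> (\<forall>n. AE x in power_space n. f n x = g n x)"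

lemma norm_add_sq: "(norm (a + b))\<^sup>2 \<le> 2 * (norm a)\<^sup>2 + 2 * (norm (b::'b::real_normed_vector))\<^sup>2"
proof -
  have "(norm (a + b))\<^sup>2 \<le> (norm a + norm b)\<^sup>2"
    by (intro power_mono norm_triangle_ineq norm_ge_zero)
  also have "\<dots> \<le> 2 * (norm a)\<^sup>2 + 2 * (norm b)\<^sup>2"
    using sum_squares_bound[of "norm a" "norm b"] by (simp add: power2_sum)
  finally show ?thesis .
qed

lemma square_integrable_zero: "square_integrable M (\<lambda>_. 0::complex)"
  by (simp add: square_integrable_def)

lemma square_integrable_add:
  fixes f g :: "_ \<Rightarrow> complex"
  assumes "square_integrable M f" "square_integrable M g"
  shows "square_integrable M (\<lambda>x. f x + g x)"
proof -
  have [measurable]: "f \<in> borel_measurable M" "g \<in> borel_measurable M"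
    using assms by (auto simp: square_integrable_def)
  have "integrable M (\<lambda>x. 2 * (norm (f x))\<^sup>2 + 2 * (norm (g x))\<^sup>2)"
    using assms by (auto simp: square_integrable_def)
  then have "integrable M (\<lambda>x. (norm (f x + g x))\<^sup>2)"
    by (rule Bochner_Integration.integrable_bound) (auto intro!: AE_I2 norm_add_sq)
  then show ?thesis by (simp add: square_integrable_def)
qed

lemma square_integrable_cmult:
  fixes f :: "_ \<Rightarrow> complex"
  shows "square_integrable M f \<Longrightarrow> square_integrable M (\<lambda>x. c * f x)"
  by (auto simp: square_integrable_def norm_mult power_mult_distrib)

lemma square_integrable_diff:
  fixes f g :: "_ \<Rightarrow> complex"
  assumes "square_integrable M f" "square_integrable M g"
  shows "square_integrable M (\<lambda>x. f x - g x)"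
  using square_integrable_add[OF assms(1) square_integrable_cmult[OF assms(2), of "-1"]] by simp

lemma measurable_cnj[measurable]: "cnj \<in> borel_measurable borel"
  by (intro borel_measurable_continuous_onI continuous_intros)

lemma norm_cnj_mult_le: "norm (cnj a * b) \<le> (cmod a)\<^sup>2 + (cmod b)\<^sup>2"
proof -
  have "0 \<le> cmod a * cmod b" by simp
  with sum_squares_bound[of "cmod a" "cmod b"] show ?thesis
    unfolding norm_mult complex_mod_cnj by linarith
qed

lemma integrable_cnj_mult:
  fixes f g :: "_ \<Rightarrow> complex"
  assumes "square_integrable M f" "square_integrable M g"
  shows "integrable M (\<lambda>x. cnj (f x) * g x)"
proof -
  have [measurable]: "f \<in> borel_measurable M" "g \<in> borel_measurable M"
    using assms by (auto simp: square_integrable_def)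
  have "integrable M (\<lambda>x. (norm (f x))\<^sup>2 + (norm (g x))\<^sup>2)"
    using assms by (auto simp: square_integrable_def)
  then show ?thesis
    by (rule Bochner_Integration.integrable_bound) (use norm_cnj_mult_le in \<open>auto intro!: AE_I2\<close>)
qed

lemma norm_integral_cnj_mult_le:
  fixes f g :: "_ \<Rightarrow> complex"
  assumes "square_integrable M f" "square_integrable M g"
  shows "norm (\<integral>x. cnj (f x) * g x \<partial>M) \<le> (\<integral>x. (cmod (f x))\<^sup>2 \<partial>M) + (\<integral>x. (cmod (g x))\<^sup>2 \<partial>M)"
proof -
  have "norm (\<integral>x. cnj (f x) * g x \<partial>M) \<le> (\<integral>x. norm (cnj (f x) * g x) \<partial>M)"
    by (rule integral_norm_bound)
  also have "\<dots> \<le> (\<integral>x. (cmod (f x))\<^sup>2 + (cmod (g x))\<^sup>2 \<partial>M)"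
    using assms by (intro integral_mono integrable_norm integrable_cnj_mult norm_cnj_mult_le)
      (auto simp: square_integrable_def)
  also have "\<dots> = (\<integral>x. (cmod (f x))\<^sup>2 \<partial>M) + (\<integral>x. (cmod (g x))\<^sup>2 \<partial>M)"
    using assms by (simp add: square_integrable_def)
  finally show ?thesis .
qed

lemma integral_norm_add_sq_le:
  fixes f g :: "_ \<Rightarrow> complex"
  assumes "square_integrable M f" "square_integrable M g"
  shows "(\<integral>x. (cmod (f x + g x))\<^sup>2 \<partial>M) \<le> 2 * (\<integral>x. (cmod (f x))\<^sup>2 \<partial>M) + 2 * (\<integral>x. (cmod (g x))\<^sup>2 \<partial>M)"
proof -
  have "(\<integral>x. (cmod (f x + g x))\<^sup>2 \<partial>M) \<le> (\<integral>x. 2 * (cmod (f x))\<^sup>2 + 2 * (cmod (g x))\<^sup>2 \<partial>M)"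
    using assms square_integrable_add[OF assms]
    by (intro integral_mono norm_add_sq) (auto simp: square_integrable_def)
  also have "\<dots> = 2 * (\<integral>x. (cmod (f x))\<^sup>2 \<partial>M) + 2 * (\<integral>x. (cmod (g x))\<^sup>2 \<partial>M)"
    using assms by (simp add: square_integrable_def)
  finally show ?thesis .
qed

lemma fock_seqD:
  assumes "fock_seq f"
  shows "square_integrable (power_space n) (f n)"
    "p permutes {..<n} \<Longrightarrow> AE x in power_space n. f n (x \<circ> p) = f n x"
    "summable (\<lambda>n. \<integral>x. (cmod (f n x))\<^sup>2 \<partial>power_space n)"
    "f n \<in> borel_measurable (power_space n)"
  using assms by (auto simp: fock_seq_def square_integrable_def)

lemma fock_seq_zero: "fock_seq (\<lambda>_ _. 0)"
  by (simp add: fock_seq_def square_integrable_zero)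

lemma fock_seq_add:
  assumes "fock_seq f" "fock_seq g"
  shows "fock_seq (\<lambda>n x. f n x + g n x)"
  unfolding fock_seq_def
proof (intro conjI allI impI)
  show "square_integrable (power_space n) (\<lambda>x. f n x + g n x)" for n
    by (intro square_integrable_add fock_seqD assms)
  show "AE x in power_space n. f n (x \<circ> p) + g n (x \<circ> p) = f n x + g n x" if "p permutes {..<n}" for n p
    using fock_seqD(2)[OF assms(1) that] fock_seqD(2)[OF assms(2) that] by eventually_elim simp
  show "summable (\<lambda>n. \<integral>x. (cmod (f n x + g n x))\<^sup>2 \<partial>power_space n)"
  proof (rule summable_comparison_test')
    show "summable (\<lambda>n. 2 * (\<integral>x. (cmod (f n x))\<^sup>2 \<partial>power_space n) + 2 * (\<integral>x. (cmod (g n x))\<^sup>2 \<partial>power_space n))"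
      by (intro summable_add summable_mult fock_seqD assms)
    show "norm (\<integral>x. (cmod (f n x + g n x))\<^sup>2 \<partial>power_space n)
        \<le> 2 * (\<integral>x. (cmod (f n x))\<^sup>2 \<partial>power_space n) + 2 * (\<integral>x. (cmod (g n x))\<^sup>2 \<partial>power_space n)" if "0 \<le> n" for n
      using integral_norm_add_sq_le[OF fock_seqD(1)[OF assms(1)] fock_seqD(1)[OF assms(2)], of n] by simp
  qed
qed

lemma fock_seq_cmult:
  assumes "fock_seq f"
  shows "fock_seq (\<lambda>n x. c * f n x)"
  unfolding fock_seq_def
proof (intro conjI allI impI)
  show "square_integrable (power_space n) (\<lambda>x. c * f n x)" for n
    by (intro square_integrable_cmult fock_seqD assms)
  show "AE x in power_space n. c * f n (x \<circ> p) = c * f n x" if "p permutes {..<n}" for n p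
    using fock_seqD(2)[OF assms(1) that] by eventually_elim simp
  show "summable (\<lambda>n. \<integral>x. (cmod (c * f n x))\<^sup>2 \<partial>power_space n)"
    using summable_mult[OF fock_seqD(3)[OF assms], of "(cmod c)\<^sup>2"] 
    by (simp add: norm_mult power_mult_distrib)
qed

lemma summable_fock_inner:
  assumes "fock_seq f" "fock_seq g"
  shows "summable (\<lambda>n. \<integral>x. cnj (f n x) * g n x \<partial>power_space n)"
proof (rule summable_comparison_test')
  show "summable (\<lambda>n. (\<integral>x. (cmod (f n x))\<^sup>2 \<partial>power_space n) + (\<integral>x. (cmod (g n x))\<^sup>2 \<partial>power_space n))"
    by (intro summable_add fock_seqD assms)
qed (intro norm_integral_cnj_mult_le fock_seqD assms)

lemma fock_eq_refl: "fock_seq f \<Longrightarrow> fock_eq f f"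
  by (simp add: fock_eq_def)

lemma part_equivp_fock_eq: "part_equivp fock_eq"
proof (rule part_equivpI)
  show "\<exists>x. fock_eq x x" using fock_eq_refl fock_seq_zero by blast
  show "symp fock_eq" unfolding symp_def fock_eq_def by (auto simp: eq_commute)
  show "transp fock_eq" unfolding transp_def
  proof (intro allI impI)
    fix f g h assume "fock_eq f g" "fock_eq g h"
    then have *: "fock_seq f" "fock_seq h" "AE x in power_space n. f n x = g n x" "AE x in power_space n. g n x = h n x" for n
      by (auto simp: fock_eq_def)
    have "AE x in power_space n. f n x = h n x" for n using *(3,4)[of n] by eventually_elim simp
    with * show "fock_eq f h" by (simp add: fock_eq_def)
  qed
qed

quotient_type fock = "nat \<Rightarrow> (nat \<Rightarrow> real) \<Rightarrow> complex" / partial: fock_eq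
  by (rule part_equivp_fock_eq)

lift_definition scaleC :: "complex \<Rightarrow> fock \<Rightarrow> fock" is "\<lambda>c f n x. c * f n x"
proof -
  fix c f g assume "fock_eq f g"
  then have *: "fock_seq f" "fock_seq g" "AE x in power_space n. f n x = g n x" for n
    by (auto simp: fock_eq_def)
  have "AE x in power_space n. c * f n x = c * g n x" for n using *(3)[of n] by eventually_elim simp
  with * show "fock_eq (\<lambda>n x. c * f n x) (\<lambda>n x. c * g n x)" by (simp add: fock_eq_def fock_seq_cmult)
qed

lift_definition cinner :: "fock \<Rightarrow> fock \<Rightarrow> complex" is
  "\<lambda>f g. \<Sum>n. \<integral>x. cnj (f n x) * g n x \<partial>power_space n"
proof -
  fix f f' g g' assume "fock_eq f f'" "fock_eq g g'"
  then have *: "fock_seq f" "fock_seq f'" "fock_seq g" "fock_seq g'" 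
    "AE x in power_space n. f n x = f' n x" "AE x in power_space n. g n x = g' n x" for n
    by (auto simp: fock_eq_def)
  have "(\<integral>x. cnj (f n x) * g n x \<partial>power_space n) = (\<integral>x. cnj (f' n x) * g' n x \<partial>power_space n)" for n
  proof (rule integral_cong_AE)
    note [measurable] = *(1-4)[THEN fock_seqD(4)]
    show "(\<lambda>x. cnj (f n x) * g n x) \<in> borel_measurable (power_space n)"
       "(\<lambda>x. cnj (f' n x) * g' n x) \<in> borel_measurable (power_space n)" by measurable
    show "AE x in power_space n. cnj (f n x) * g n x = cnj (f' n x) * g' n x"
      using *(5,6)[of n] by eventually_elim simp
  qed
  then show "(\<Sum>n. \<integral>x. cnj (f n x) * g n x \<partial>power_space n) = (\<Sum>n. \<integral>x. cnj (f' n x) * g' n x \<partial>power_space n)"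
    by simp
qed

text \<open>
  The real inner product is the real part of \<open>cinner\<close> (which is linear in its second argument), so
  that \<open>norm\<close> is the Hilbert space norm and the \<open>blinfun\<close> norm of a complex-linear operator is its
  operator norm.
\<close>

instantiation fock :: real_inner
begin

lift_definition zero_fock :: fock is "\<lambda>_ _. 0"
  by (intro fock_eq_refl fock_seq_zero)

lift_definition plus_fock :: "fock \<Rightarrow> fock \<Rightarrow> fock" is "\<lambda>f g n x. f n x + g n x"
proof -
  fix f f' g g' assume "fock_eq f f'" "fock_eq g g'"
  then have *: "fock_seq f" "fock_seq f'" "fock_seq g" "fock_seq g'" 
    "AE x in power_space n. f n x = f' n x" "AE x in power_space n. g n x = g' n x" for n
    by (auto simp: fock_eq_def)
  have "AE x in power_space n. f n x + g n x = f' n x + g' n x" for n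
    using *(5,6)[of n] by eventually_elim simp
  with * show "fock_eq (\<lambda>n x. f n x + g n x) (\<lambda>n x. f' n x + g' n x)"
    by (simp add: fock_eq_def fock_seq_add)
qed

definition uminus_fock :: "fock \<Rightarrow> fock" where "uminus_fock x = scaleC (- 1) x"
definition minus_fock :: "fock \<Rightarrow> fock \<Rightarrow> fock" where "minus_fock x y = x + (- y)"
definition scaleR_fock :: "real \<Rightarrow> fock \<Rightarrow> fock" where "scaleR_fock r x = scaleC (of_real r) x"
definition inner_fock :: "fock \<Rightarrow> fock \<Rightarrow> real" where "inner_fock x y = Re (cinner x y)"
definition norm_fock :: "fock \<Rightarrow> real" where "norm_fock x = sqrt (inner x x)"
definition sgn_fock :: "fock \<Rightarrow> fock" where "sgn_fock x = scaleR (inverse (norm x)) x"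
definition dist_fock :: "fock \<Rightarrow> fock \<Rightarrow> real" where "dist_fock x y = norm (x - y)"
definition uniformity_fock :: "(fock \<times> fock) filter" where
  "uniformity_fock = (INF e\<in>{0 <..}. principal {(x, y). dist x y < e})"
definition open_fock :: "fock set \<Rightarrow> bool" where
  "open_fock U \<longleftrightarrow> (\<forall>x\<in>U. \<forall>\<^sub>F (x', y) in uniformity. x' = x \<longrightarrow> y \<in> U)"

lemma fock_eqI: "fock_seq f \<Longrightarrow> (\<And>n x. f n x = g n x) \<Longrightarrow> fock_eq f g"
  by (metis (no_types, lifting) ext fock_eq_refl)

lemma fock_eq_seq: "fock_eq f f \<longleftrightarrow> fock_seq f"
  by (simp add: fock_eq_def)

lemma scaleC_simps:
  "scaleC a (scaleC b x) = scaleC (a * b) x"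
  "scaleC 1 x = x"
  "scaleC a (x + y) = scaleC a x + scaleC a y"
  "scaleC (a + b) x = scaleC a x + scaleC b x"
  "scaleC 0 x = 0"
  by (transfer; rule fock_eqI; auto intro!: fock_seq_cmult fock_seq_add fock_seq_zero simp: algebra_simps fock_eq_seq)+

lemma cinner_commute: "cinner x y = cnj (cinner y x)"
proof (transfer)
  fix f g assume "fock_eq f f" "fock_eq g g"
  then have "summable (\<lambda>n. \<integral>x. cnj (g n x) * f n x \<partial>power_space n)"
    by (intro summable_fock_inner) (auto simp: fock_eq_seq)
  then have "cnj (\<Sum>n. \<integral>x. cnj (g n x) * f n x \<partial>power_space n) = (\<Sum>n. cnj (\<integral>x. cnj (g n x) * f n x \<partial>power_space n))"
    by (rule bounded_linear.suminf[OF bounded_linear_cnj])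
  also have "\<dots> = (\<Sum>n. \<integral>x. cnj (f n x) * g n x \<partial>power_space n)"
    by (rule arg_cong[where f = suminf], rule ext, subst Bochner_Integration.integral_cnj[symmetric], simp add: mult.commute)
  finally show "(\<Sum>n. \<integral>x. cnj (f n x) * g n x \<partial>power_space n) = cnj (\<Sum>n. \<integral>x. cnj (g n x) * f n x \<partial>power_space n)" ..
qed

lemma cinner_add_right: "cinner x (y + z) = cinner x y + cinner x z"
proof (transfer)
  fix f g h assume "fock_eq f f" "fock_eq g g" "fock_eq h h"
  then have *: "fock_seq f" "fock_seq g" "fock_seq h" by (auto simp: fock_eq_seq)
  have "(\<integral>x. cnj (f n x) * (g n x + h n x) \<partial>power_space n) =
     (\<integral>x. cnj (f n x) * g n x \<partial>power_space n) + (\<integral>x. cnj (f n x) * h n x \<partial>power_space n)" for n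
    using * by (simp add: distrib_left integrable_cnj_mult fock_seqD)
  then show "(\<Sum>n. \<integral>x. cnj (f n x) * (g n x + h n x) \<partial>power_space n) =
     (\<Sum>n. \<integral>x. cnj (f n x) * g n x \<partial>power_space n) + (\<Sum>n. \<integral>x. cnj (f n x) * h n x \<partial>power_space n)"
    using * by (simp add: suminf_add summable_fock_inner)
qed

lemma cinner_scaleC_right: "cinner x (scaleC c y) = c * cinner x y"
proof (transfer)
  fix c f g assume "fock_eq f f" "fock_eq g g"
  then have *: "fock_seq f" "fock_seq g" by (auto simp: fock_eq_seq)
  have "(\<integral>x. cnj (f n x) * (c * g n x) \<partial>power_space n) = c * (\<integral>x. cnj (f n x) * g n x \<partial>power_space n)" for n
    by (subst integral_mult_right_zero[symmetric]) (simp add: mult_ac)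
  then show "(\<Sum>n. \<integral>x. cnj (f n x) * (c * g n x) \<partial>power_space n) =
     c * (\<Sum>n. \<integral>x. cnj (f n x) * g n x \<partial>power_space n)"
    using * by (simp add: suminf_mult summable_fock_inner)
qed

lemma cinner_self: "fock_seq f \<Longrightarrow> (\<Sum>n. \<integral>x. cnj (f n x) * f n x \<partial>power_space n) =
    complex_of_real (\<Sum>n. \<integral>x. (cmod (f n x))\<^sup>2 \<partial>power_space n)"
proof -
  assume f: "fock_seq f"
  have "(\<integral>x. cnj (f n x) * f n x \<partial>power_space n) = complex_of_real (\<integral>x. (cmod (f n x))\<^sup>2 \<partial>power_space n)" for n
    by (simp flip: complex_norm_square integral_complex_of_real add: mult.commute)
  then show ?thesis using fock_seqD(3)[OF f] by (simp add: suminf_of_real)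
qed

instance
proof
  fix x y z :: fock and a b r :: real
  show "x + y + z = x + (y + z)" "x + y = y + x" "0 + x = x"
    by (transfer; rule fock_eqI; auto intro!: fock_seq_cmult fock_seq_add fock_seq_zero simp: algebra_simps fock_eq_seq)+
  show "- x + x = 0"
    using scaleC_simps(4)[of "-1" 1 x] by (simp add: uminus_fock_def scaleC_simps)
  show "x - y = x + - y" by (simp add: minus_fock_def)
  show "a *\<^sub>R (x + y) = a *\<^sub>R x + a *\<^sub>R y" "(a + b) *\<^sub>R x = a *\<^sub>R x + b *\<^sub>R x"
    "a *\<^sub>R b *\<^sub>R x = (a * b) *\<^sub>R x" "1 *\<^sub>R x = x"
    by (simp_all add: scaleR_fock_def scaleC_simps)
  show "sgn x = inverse (norm x) *\<^sub>R x" by (rule sgn_fock_def)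
  show "dist x y = norm (x - y)" by (rule dist_fock_def)
  show "uniformity = (INF e\<in>{0 <..}. principal {(x, y::fock). dist x y < e})"
    by (rule uniformity_fock_def)
  show "open U \<longleftrightarrow> (\<forall>x\<in>U. \<forall>\<^sub>F (x', y) in uniformity. x' = x \<longrightarrow> y \<in> U)" for U :: "fock set"
    by (rule open_fock_def)
  show comm: "inner x y = inner y x" for x y :: fock
    by (metis inner_fock_def cinner_commute cnj.simps(1))
  show "inner (x + y) z = inner x z + inner y z"
    by (subst (1 2 3) comm) (simp add: inner_fock_def cinner_add_right)
  show "inner (r *\<^sub>R x) y = r * inner x y"
    by (subst (1 2) comm) (simp add: inner_fock_def scaleR_fock_def cinner_scaleC_right)
  show "norm x = sqrt (inner x x)" by (rule norm_fock_def)
  have "0 \<le> inner x x \<and> (inner x x = 0 \<longleftrightarrow> x = 0)"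
    unfolding inner_fock_def
  proof (transfer)
    fix f assume "fock_eq f f"
    then have f: "fock_seq f" by (simp add: fock_eq_seq)
    have 1: "Re (\<Sum>n. \<integral>x. cnj (f n x) * f n x \<partial>power_space n) = (\<Sum>n. \<integral>x. (cmod (f n x))\<^sup>2 \<partial>power_space n)"
      using cinner_self[OF f] by simp
    have 2: "(\<Sum>n. \<integral>x. (cmod (f n x))\<^sup>2 \<partial>power_space n) = 0 \<longleftrightarrow> (\<forall>n. (\<integral>x. (cmod (f n x))\<^sup>2 \<partial>power_space n) = 0)"
      by (rule suminf_eq_zero_iff) (use fock_seqD(3)[OF f] in auto)
    have 3: "(\<integral>x. (cmod (f n x))\<^sup>2 \<partial>power_space n) = 0 \<longleftrightarrow> (AE x in power_space n. f n x = 0)" for n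
      using fock_seqD(1)[OF f, of n] 
      by (subst integral_nonneg_eq_0_iff_AE) (auto simp: square_integrable_def)
    have "0 \<le> (\<Sum>n. \<integral>x. (cmod (f n x))\<^sup>2 \<partial>power_space n)"
      by (intro suminf_nonneg fock_seqD f) simp
    then show "0 \<le> Re (\<Sum>n. \<integral>x. cnj (f n x) * f n x \<partial>power_space n) \<and>
       (Re (\<Sum>n. \<integral>x. cnj (f n x) * f n x \<partial>power_space n) = 0 \<longleftrightarrow> fock_eq f (\<lambda>_ _. 0))"
      unfolding 1 2 3 using f fock_seq_zero by (simp add: fock_eq_def)
  qed
  then show "0 \<le> inner x x" "inner x x = 0 \<longleftrightarrow> x = 0" by auto
qed

end

lemma (in sigma_finite_measure) L2_complete:
  fixes s :: "nat \<Rightarrow> 'a \<Rightarrow> complex"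
  assumes s: "\<And>n. square_integrable M (s n)"
    and cau: "\<And>e. 0 < e \<Longrightarrow> \<exists>N. \<forall>i\<ge>N. \<forall>j\<ge>N. (\<integral>x. (cmod (s i x - s j x))\<^sup>2 \<partial>M) < e"
  obtains f where "square_integrable M f" "(\<lambda>i. \<integral>x. (cmod (s i x - f x))\<^sup>2 \<partial>M) \<longlonglongrightarrow> 0"
proof -
  note [measurable] = s[unfolded square_integrable_def, THEN conjunct1]
  obtain h :: "'a \<Rightarrow> real" where h[measurable]: "h \<in> borel_measurable M" and hpos: "\<And>x. h x > 0" and "\<And>x. h x \<le> 1" and hint: "integrable M h"
    using obtain_positive_integrable_function by metis
  define w where "w = (\<lambda>x. complex_of_real (sqrt (h x)))"
  have [measurable]: "w \<in> borel_measurable M" unfolding w_def by measurable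
  have wsq: "(cmod (w x))\<^sup>2 = h x" for x using hpos[of x] by (simp add: w_def)
  have w0: "w x \<noteq> 0" for x using hpos[of x] by (simp add: w_def)
  have w: "square_integrable M w" using hint by (simp add: square_integrable_def wsq)
  have cw: "cnj (w x) = w x" for x by (simp add: w_def)
  define H where "H = (\<integral>x. h x \<partial>M)"
  have H: "H \<ge> 0" unfolding H_def using hpos by (intro integral_nonneg_AE) (auto simp: less_imp_le)
  have int: "integrable M (\<lambda>x. w x * s n x)" for n
    using integrable_cnj_mult[OF w s] by (simp add: cw)
  have sqd: "integrable M (\<lambda>x. (cmod (s i x - s j x))\<^sup>2)" for i j
    using square_integrable_diff[OF s s, of i j] by (simp add: square_integrable_def)
  have "\<exists>N. \<forall>i\<ge>N. \<forall>j\<ge>N. (\<integral>x. norm (w x * s i x - w x * s j x) \<partial>M) < e" if e: "0 < e" for e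
  proof -
    define t where "t = e / (2 * (H + 1))"
    have t: "t > 0" using e H by (simp add: t_def)
    obtain N where N: "\<And>i j. i \<ge> N \<Longrightarrow> j \<ge> N \<Longrightarrow> (\<integral>x. (cmod (s i x - s j x))\<^sup>2 \<partial>M) < t * e / 2"
      using cau[of "t * e / 2"] t e by auto
    have "(\<integral>x. norm (w x * s i x - w x * s j x) \<partial>M) < e" if ij: "i \<ge> N" "j \<ge> N" for i j
    proof -
      have "(\<integral>x. norm (w x * s i x - w x * s j x) \<partial>M) \<le> (\<integral>x. t * h x + (cmod (s i x - s j x))\<^sup>2 / t \<partial>M)"
      proof (rule integral_mono)
        show "integrable M (\<lambda>x. norm (w x * s i x - w x * s j x))"
          by (intro integrable_norm Bochner_Integration.integrable_diff int)
        show "integrable M (\<lambda>x. t * h x + (cmod (s i x - s j x))\<^sup>2 / t)"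
          using hint sqd[of i j] by auto
        show "norm (w x * s i x - w x * s j x) \<le> t * h x + (cmod (s i x - s j x))\<^sup>2 / t" for x
        proof -
          define a b where "a = cmod (w x)" and "b = cmod (s i x - s j x)"
          have "2 * (t * a) * b \<le> (t * a)\<^sup>2 + b\<^sup>2" by (rule sum_squares_bound)
          moreover have "0 \<le> (t * a) * b" using t by (simp add: a_def b_def)
          ultimately have "t * (a * b) \<le> t * (t * a\<^sup>2 + b\<^sup>2 / t)" using t
            by (simp add: power2_eq_square algebra_simps)
          then have "a * b \<le> t * a\<^sup>2 + b\<^sup>2 / t" using t by simp
          moreover have "norm (w x * s i x - w x * s j x) = a * b"
            by (simp add: a_def b_def norm_mult flip: right_diff_distrib)
          ultimately show ?thesis by (simp add: a_def b_def wsq)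
        qed
      qed
      also have "\<dots> = t * H + (\<integral>x. (cmod (s i x - s j x))\<^sup>2 \<partial>M) / t"
        using hint sqd[of i j] by (simp add: H_def)
      also have "\<dots> < t * H + (t * e / 2) / t"
        using divide_strict_right_mono[OF N[OF ij] t] by (rule add_strict_left_mono)
      also have "\<dots> = t * H + e / 2" using t by simp
      also have "t * H \<le> e / 2" using e H by (simp add: t_def field_simps)
      finally show ?thesis by simp
    qed
    then show ?thesis by blast
  qed
  from cauchy_L1_AE_cauchy_subseq[OF int this]
  obtain r :: "nat \<Rightarrow> nat" where r: "strict_mono r" and AEw: "AE x in M. Cauchy (\<lambda>i. w x * s (r i) x)"
    by blast
  from AEw have AEc: "AE x in M. convergent (\<lambda>i. s (r i) x)"
  proof eventually_elim
    case (elim x)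
    then have "convergent (\<lambda>i. w x * s (r i) x)" by (simp add: Cauchy_convergent_iff)
    then have "convergent (\<lambda>i. inverse (w x) * (w x * s (r i) x))"
      by (rule convergent_mult[OF convergent_const])
    then show ?case using w0[of x] by (simp flip: mult.assoc)
  qed
  define f where "f = (\<lambda>x. lim (\<lambda>i. s (r i) x))"
  have [measurable]: "f \<in> borel_measurable M" unfolding f_def by measurable
  have AEf: "AE x in M. (\<lambda>i. s (r i) x) \<longlonglongrightarrow> f x"
    using AEc by eventually_elim (simp add: f_def convergent_LIMSEQ_iff)
  have key: "\<exists>N. \<forall>k\<ge>N. (\<integral>\<^sup>+x. ennreal ((cmod (s k x - f x))\<^sup>2) \<partial>M) \<le> ennreal e" if e: "0 < e" for e
  proof -
    obtain N where N: "\<And>i j. i \<ge> N \<Longrightarrow> j \<ge> N \<Longrightarrow> (\<integral>x. (cmod (s i x - s j x))\<^sup>2 \<partial>M) < e"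
      using cau[OF e] by auto
    have "(\<integral>\<^sup>+x. ennreal ((cmod (s k x - f x))\<^sup>2) \<partial>M) \<le> ennreal e" if k: "k \<ge> N" for k
    proof -
      have "(\<integral>\<^sup>+x. ennreal ((cmod (s k x - f x))\<^sup>2) \<partial>M) = (\<integral>\<^sup>+x. liminf (\<lambda>i. ennreal ((cmod (s k x - s (r i) x))\<^sup>2)) \<partial>M)"
      proof (rule nn_integral_cong_AE, use AEf in eventually_elim)
        case (elim x)
        then have "(\<lambda>i. ennreal ((cmod (s k x - s (r i) x))\<^sup>2)) \<longlonglongrightarrow> ennreal ((cmod (s k x - f x))\<^sup>2)"
          by (intro tendsto_intros)
        from lim_imp_Liminf[OF trivial_limit_sequentially this] show ?case by (rule sym)
      qed
      also have "\<dots> \<le> liminf (\<lambda>i. \<integral>\<^sup>+x. ennreal ((cmod (s k x - s (r i) x))\<^sup>2) \<partial>M)"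
        by (rule nn_integral_liminf) measurable
      also have "\<dots> \<le> ennreal e"
      proof (rule Liminf_le)
        show "\<forall>\<^sub>F i in sequentially. (\<integral>\<^sup>+x. ennreal ((cmod (s k x - s (r i) x))\<^sup>2) \<partial>M) \<le> ennreal e"
        proof (rule eventually_sequentiallyI[of N])
          fix i assume "i \<ge> N"
          then have "r i \<ge> N" using r by (meson le_trans seq_suble)
          then have "(\<integral>x. (cmod (s k x - s (r i) x))\<^sup>2 \<partial>M) < e" using N k by blast
          then show "(\<integral>\<^sup>+x. ennreal ((cmod (s k x - s (r i) x))\<^sup>2) \<partial>M) \<le> ennreal e"
            using sqd by (subst nn_integral_eq_integral) (auto intro: ennreal_leI)
        qed
      qed simp
      finally show ?thesis .
    qed
    then show ?thesis by blast
  qed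
  obtain N where N: "\<And>k. k \<ge> N \<Longrightarrow> (\<integral>\<^sup>+x. ennreal ((cmod (s k x - f x))\<^sup>2) \<partial>M) \<le> ennreal 1"
    using key[of 1] by auto
  have "integrable M (\<lambda>x. (cmod (s N x - f x))\<^sup>2)"
    using N[of N] by (intro integrableI_bounded) (auto intro: le_less_trans)
  then have "square_integrable M (\<lambda>x. s N x - f x)" by (simp add: square_integrable_def)
  from square_integrable_diff[OF s[of N] this] have f: "square_integrable M f" by simp
  moreover have "(\<lambda>i. \<integral>x. (cmod (s i x - f x))\<^sup>2 \<partial>M) \<longlonglongrightarrow> 0"
  proof (rule LIMSEQ_I)
    fix e :: real assume "0 < e"
    then obtain N where N: "\<And>k. k \<ge> N \<Longrightarrow> (\<integral>\<^sup>+x. ennreal ((cmod (s k x - f x))\<^sup>2) \<partial>M) \<le> ennreal (e/2)"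
      using key[of "e/2"] by auto
    have "norm ((\<integral>x. (cmod (s i x - f x))\<^sup>2 \<partial>M) - 0) < e" if "i \<ge> N" for i
    proof -
      have "integrable M (\<lambda>x. (cmod (s i x - f x))\<^sup>2)"
        using square_integrable_diff[OF s f, of i] by (simp add: square_integrable_def)
      then have "ennreal (\<integral>x. (cmod (s i x - f x))\<^sup>2 \<partial>M) \<le> ennreal (e/2)"
        using N[OF that] by (subst (asm) nn_integral_eq_integral) auto
      then show ?thesis using \<open>0 < e\<close> by (auto simp: ennreal_le_iff)
    qed
    then show "\<exists>no. \<forall>n\<ge>no. norm ((\<integral>x. (cmod (s n x - f x))\<^sup>2 \<partial>M) - 0) < e" by blast
  qed
  ultimately show ?thesis by (rule that)
qed

lemma L2_dominated:
  fixes s :: "nat \<Rightarrow> 'a \<Rightarrow> complex"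
  assumes f: "square_integrable M f" and [measurable]: "\<And>i. s i \<in> borel_measurable M"
    and lim: "\<And>x. x \<in> space M \<Longrightarrow> (\<lambda>i. s i x) \<longlonglongrightarrow> f x"
    and bound: "\<And>i x. x \<in> space M \<Longrightarrow> cmod (s i x) \<le> 2 * cmod (f x)"
  shows "(\<lambda>i. \<integral>x. (cmod (f x - s i x))\<^sup>2 \<partial>M) \<longlonglongrightarrow> 0"
proof -
  have [measurable]: "f \<in> borel_measurable M" and int: "integrable M (\<lambda>x. (cmod (f x))\<^sup>2)"
    using f by (auto simp: square_integrable_def)
  have "(\<lambda>i. \<integral>x. (cmod (f x - s i x))\<^sup>2 \<partial>M) \<longlonglongrightarrow> (\<integral>x. 0 \<partial>M)"
  proof (rule integral_dominated_convergence)
    show "integrable M (\<lambda>x. 9 * (cmod (f x))\<^sup>2)" using int by simp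
    show "AE x in M. (\<lambda>i. (cmod (f x - s i x))\<^sup>2) \<longlonglongrightarrow> 0"
    proof (rule AE_I2)
      fix x assume "x \<in> space M"
      from tendsto_power[OF tendsto_norm[OF tendsto_diff[OF tendsto_const[of "f x"] lim[OF this]]], of 2]
      show "(\<lambda>i. (cmod (f x - s i x))\<^sup>2) \<longlonglongrightarrow> 0" by simp
    qed
    show "AE x in M. norm ((cmod (f x - s i x))\<^sup>2) \<le> 9 * (cmod (f x))\<^sup>2" for i
    proof (rule AE_I2)
      fix x assume x: "x \<in> space M"
      have "cmod (f x - s i x) \<le> cmod (f x) + cmod (s i x)" by (rule norm_triangle_ineq4)
      also have "\<dots> \<le> 3 * cmod (f x)" using bound[OF x, of i] by simp
      finally have "(cmod (f x - s i x))\<^sup>2 \<le> (3 * cmod (f x))\<^sup>2" by (intro power_mono) auto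
      then show "norm ((cmod (f x - s i x))\<^sup>2) \<le> 9 * (cmod (f x))\<^sup>2" by (simp add: power_mult_distrib)
    qed
  qed measurable
  then show ?thesis by simp
qed

lemma L2_dominated_si:
  fixes s :: "'a \<Rightarrow> complex"
  assumes f: "square_integrable M f" and [measurable]: "s \<in> borel_measurable M"
    and bound: "\<And>x. x \<in> space M \<Longrightarrow> cmod (s x) \<le> 2 * cmod (f x)"
  shows "square_integrable M s"
proof -
  have "integrable M (\<lambda>x. 4 * (cmod (f x))\<^sup>2)"
    using f by (auto simp: square_integrable_def)
  then have "integrable M (\<lambda>x. (cmod (s x))\<^sup>2)"
  proof (rule Bochner_Integration.integrable_bound)
    show "AE x in M. norm ((cmod (s x))\<^sup>2) \<le> norm (4 * (cmod (f x))\<^sup>2)"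
    proof (rule AE_I2)
      fix x assume "x \<in> space M"
      from power_mono[OF bound[OF this], of 2] 
      show "norm ((cmod (s x))\<^sup>2) \<le> norm (4 * (cmod (f x))\<^sup>2)" by (simp add: power_mult_distrib)
    qed
  qed measurable
  then show ?thesis by (simp add: square_integrable_def)
qed

lemma (in sigma_finite_measure) L2_separable:
  assumes G: "countable G" "G \<subseteq> Pow (space M)" "sets M = sigma_sets (space M) G"
  obtains D :: "('a \<Rightarrow> complex) set" where "countable D" "\<And>g. g \<in> D \<Longrightarrow> square_integrable M g"
    "\<And>f e. square_integrable M f \<Longrightarrow> 0 < e \<Longrightarrow> \<exists>g\<in>D. (\<integral>x. (cmod (f x - g x))\<^sup>2 \<partial>M) < e"
proof -
  obtain A :: "nat \<Rightarrow> 'a set" where A: "range A \<subseteq> sets M" "(\<Union>i. A i) = space M"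
    "\<And>i. emeasure M (A i) \<noteq> \<infinity>" "incseq A" using sigma_finite_incseq by blast
  have [measurable]: "A i \<in> sets M" for i using A by auto
  obtain Q :: "complex set" where Q: "countable Q" "\<And>X. open X \<Longrightarrow> X \<noteq> {} \<Longrightarrow> \<exists>d\<in>Q. d \<in> X"
    by (erule countable_dense_setE)
  define G' where "G' = (\<lambda>F. space M \<inter> \<Inter>F) ` {F. finite F \<and> F \<subseteq> G}"
  have cG': "countable G'" unfolding G'_def
    by (intro countable_image countable_Collect_finite_subset G)
  have GM: "X \<in> sets M" if "X \<in> G" for X using G(3) that by auto
  have G'M: "X \<in> sets M" if "X \<in> G'" for X
  proof -
    from that obtain F where F: "finite F" "F \<subseteq> G" "X = space M \<inter> \<Inter>F" by (auto simp: G'_def)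
    show ?thesis
    proof (cases "F = {}")
      case False
      then have "\<Inter>F \<in> sets M" using F GM by (intro sets.finite_INT[of F "\<lambda>x. x", simplified]) auto
      then show ?thesis using F by auto
    qed (use F in auto)
  qed
  have GG': "G \<subseteq> G'"
  proof
    fix X assume "X \<in> G"
    then have "X = space M \<inter> \<Inter>{X}" using G(2) by auto
    then show "X \<in> G'" using \<open>X \<in> G\<close> unfolding G'_def by blast
  qed
  have G'sub: "G' \<subseteq> Pow (space M)" by (auto simp: G'_def)
  have sG': "sets M = sigma_sets (space M) G'"
  proof
    show "sets M \<subseteq> sigma_sets (space M) G'" unfolding G(3) by (rule sigma_sets_mono'[OF GG'])
    show "sigma_sets (space M) G' \<subseteq> sets M" by (rule sets.sigma_sets_subset) (use G'M in auto)
  qed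
  have Int: "Int_stable G'"
  proof (rule Int_stableI)
    fix a b assume "a \<in> G'" "b \<in> G'"
    then obtain F1 F2 where "finite F1" "F1 \<subseteq> G" "a = space M \<inter> \<Inter>F1" "finite F2" "F2 \<subseteq> G" "b = space M \<inter> \<Inter>F2"
      by (auto simp: G'_def)
    then have "a \<inter> b = space M \<inter> \<Inter>(F1 \<union> F2)" "finite (F1 \<union> F2)" "F1 \<union> F2 \<subseteq> G" by auto
    then show "a \<inter> b \<in> G'" unfolding G'_def by blast
  qed
  define P where "P = Q \<times> (\<lambda>(X, i). X \<inter> A i) ` (G' \<times> (UNIV :: nat set))"
  define h where "h = (\<lambda>l (x::'a). \<Sum>(q, B)\<leftarrow>l. q * (indicator B x :: complex))"
  define D where "D = h ` lists P"
  have ind: "square_integrable M (\<lambda>x. c * indicator (X \<inter> A i) x)" if [measurable]: "X \<in> sets M" for X and c :: complex and i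
  proof -
    have "emeasure M (X \<inter> A i) \<le> emeasure M (A i)" by (intro emeasure_mono) auto
    also have "\<dots> < \<infinity>" using A(3)[of i] by (simp add: less_top)
    finally have "integrable M (\<lambda>x. (cmod c)\<^sup>2 * indicator (X \<inter> A i) x :: real)"
      by auto
    moreover have "(\<lambda>x. (cmod (c * indicator (X \<inter> A i) x))\<^sup>2) = (\<lambda>x. (cmod c)\<^sup>2 * indicator (X \<inter> A i) x)"
      by (auto simp: indicator_def)
    ultimately show ?thesis unfolding square_integrable_def by simp
  qed
  have hD: "square_integrable M (h l)" if "l \<in> lists P" for l
    using that
  proof induction
    case Nil then show ?case by (simp add: h_def square_integrable_zero)
  next
    case (Cons p l)
    then obtain q X i where p: "p = (q, X \<inter> A i)" "X \<in> G'" by (auto simp: P_def)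
    have "h (p # l) = (\<lambda>x. q * indicator (X \<inter> A i) x + h l x)" by (simp add: h_def p)
    then show ?case using square_integrable_add[OF ind[OF G'M[OF p(2)]] Cons(3)] by simp
  qed
  have h_append: "h (l1 @ l2) x = h l1 x + h l2 x" for l1 l2 x by (simp add: h_def)
  define appr where "appr f \<longleftrightarrow> square_integrable M f \<and> (\<forall>e>0. \<exists>g\<in>D. (\<integral>x. (cmod (f x - g x))\<^sup>2 \<partial>M) < e)" for f
  have apprE: "\<exists>l\<in>lists P. (\<integral>x. (cmod (f x - h l x))\<^sup>2 \<partial>M) < e" if "appr f" "0 < e" for f e
    using that unfolding appr_def D_def by simp
  have appr_zero: "appr (\<lambda>_. 0)"
  proof -
    have "(\<lambda>_. 0) \<in> D" unfolding D_def by (rule image_eqI[of _ _ "[]"]) (auto simp: h_def)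
    then show ?thesis unfolding appr_def using square_integrable_zero[of M] by (auto intro!: bexI[of _ "\<lambda>_. 0"])
  qed
  have appr_cong: "appr g" if "appr f" "g \<in> borel_measurable M" "\<And>x. x \<in> space M \<Longrightarrow> f x = g x" for f g
  proof -
    have "square_integrable M g" using that(1) L2_dominated_si[of M f g] that by (auto simp: appr_def)
    moreover have "(\<integral>x. (cmod (f x - u x))\<^sup>2 \<partial>M) = (\<integral>x. (cmod (g x - u x))\<^sup>2 \<partial>M)" for u
      by (rule Bochner_Integration.integral_cong) (auto simp: that)
    ultimately show ?thesis using that(1) by (simp add: appr_def)
  qed
  have appr_add: "appr (\<lambda>x. f1 x + f2 x)" if f: "appr f1" "appr f2" for f1 f2
    unfolding appr_def
  proof (intro conjI allI impI)
    have sq: "square_integrable M f1" "square_integrable M f2" using f by (auto simp: appr_def)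
    then show "square_integrable M (\<lambda>x. f1 x + f2 x)" by (rule square_integrable_add)
    fix e :: real assume "0 < e"
    then have e4: "0 < e / 4" by simp
    obtain l1 l2 where l: "l1 \<in> lists P" "l2 \<in> lists P"
      "(\<integral>x. (cmod (f1 x - h l1 x))\<^sup>2 \<partial>M) < e/4" "(\<integral>x. (cmod (f2 x - h l2 x))\<^sup>2 \<partial>M) < e/4"
      using apprE[OF f(1) e4] apprE[OF f(2) e4] by blast
    have "(\<integral>x. (cmod ((f1 x - h l1 x) + (f2 x - h l2 x)))\<^sup>2 \<partial>M) \<le>
       2 * (\<integral>x. (cmod (f1 x - h l1 x))\<^sup>2 \<partial>M) + 2 * (\<integral>x. (cmod (f2 x - h l2 x))\<^sup>2 \<partial>M)"
      by (intro integral_norm_add_sq_le square_integrable_diff sq hD l)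
    also have "\<dots> < e" using l by simp
    finally have "(\<integral>x. (cmod (f1 x + f2 x - h (l1 @ l2) x))\<^sup>2 \<partial>M) < e"
      by (simp add: h_append algebra_simps)
    moreover have "h (l1 @ l2) \<in> D" unfolding D_def using l by (intro imageI) auto
    ultimately show "\<exists>g\<in>D. (\<integral>x. (cmod (f1 x + f2 x - g x))\<^sup>2 \<partial>M) < e" by blast
  qed
  have appr_sum: "appr (\<lambda>x. \<Sum>j\<in>J. f j x)" if "finite J" "\<And>j. j \<in> J \<Longrightarrow> appr (f j)" for J :: "'j set" and f
    using that by (induction J rule: finite_induct) (auto intro!: appr_zero appr_add)
  have appr_lim: "appr f" if f: "square_integrable M f" and s: "\<And>i. appr (s i)"
    and lim: "(\<lambda>i. \<integral>x. (cmod (f x - s i x))\<^sup>2 \<partial>M) \<longlonglongrightarrow> 0" for f and s :: "nat \<Rightarrow> 'a \<Rightarrow> complex"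
    unfolding appr_def
  proof (intro conjI allI impI f)
    fix e :: real assume e: "0 < e"
    obtain N where "\<forall>n\<ge>N. norm ((\<integral>x. (cmod (f x - s n x))\<^sup>2 \<partial>M) - 0) < e/4"
      using LIMSEQ_D[OF lim, of "e/4"] e by auto
    then have N: "(\<integral>x. (cmod (f x - s N x))\<^sup>2 \<partial>M) < e/4" by auto
    have sq: "square_integrable M (s N)" using s by (auto simp: appr_def)
    have "0 < e / 4" using e by simp
    from apprE[OF s[of N] this] obtain g where g: "g \<in> D" "(\<integral>x. (cmod (s N x - g x))\<^sup>2 \<partial>M) < e/4"
      unfolding D_def by blast
    then have sg: "square_integrable M g" using hD by (auto simp: D_def)
    have "(\<integral>x. (cmod ((f x - s N x) + (s N x - g x)))\<^sup>2 \<partial>M) \<le>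
       2 * (\<integral>x. (cmod (f x - s N x))\<^sup>2 \<partial>M) + 2 * (\<integral>x. (cmod (s N x - g x))\<^sup>2 \<partial>M)"
      by (intro integral_norm_add_sq_le square_integrable_diff sq f sg)
    also have "\<dots> < e" using g N by simp
    finally show "\<exists>g\<in>D. (\<integral>x. (cmod (f x - g x))\<^sup>2 \<partial>M) < e" using g by auto
  qed
  have appr_basic: "appr (\<lambda>x. c * indicator (X \<inter> A i) x)" if X: "X \<in> G'" for X c i
    unfolding appr_def
  proof (intro conjI allI impI)
    note [measurable] = G'M[OF X]
    show "square_integrable M (\<lambda>x. c * indicator (X \<inter> A i) x)" by (rule ind) measurable
    fix e :: real assume e: "0 < e"
    define m where "m = measure M (X \<inter> A i)"
    have m: "m \<ge> 0" by (simp add: m_def)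
    define d where "d = sqrt (e / (m + 1))"
    have d: "d > 0" using e m by (simp add: d_def)
    obtain q where q: "q \<in> Q" "q \<in> ball c d" using Q(2)[of "ball c d"] d by auto
    have "(cmod (c - q))\<^sup>2 < d\<^sup>2" using q by (intro power_strict_mono) (auto simp: dist_norm)
    also have "d\<^sup>2 = e / (m + 1)" using e m by (simp add: d_def)
    finally have "(cmod (c - q))\<^sup>2 * (m + 1) < e" using m by (simp add: pos_less_divide_eq)
    moreover have "(cmod (c - q))\<^sup>2 * m \<le> (cmod (c - q))\<^sup>2 * (m + 1)" by (intro mult_left_mono) auto
    ultimately have 1: "(cmod (c - q))\<^sup>2 * m < e" by linarith
    have "(\<integral>x. (cmod (c * indicator (X \<inter> A i) x - h [(q, X \<inter> A i)] x))\<^sup>2 \<partial>M) =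
        (\<integral>x. (cmod (c - q))\<^sup>2 * indicator (X \<inter> A i) x \<partial>M)"
      by (rule Bochner_Integration.integral_cong) (auto simp: h_def indicator_def)
    also have "\<dots> = (cmod (c - q))\<^sup>2 * m"
      unfolding m_def by (subst integral_mult_right_zero) simp
    finally have "(\<integral>x. (cmod (c * indicator (X \<inter> A i) x - h [(q, X \<inter> A i)] x))\<^sup>2 \<partial>M) < e" using 1 by simp
    moreover have "h [(q, X \<inter> A i)] \<in> D" unfolding D_def using q X by (intro imageI) (auto simp: P_def)
    ultimately show "\<exists>g\<in>D. (\<integral>x. (cmod (c * indicator (X \<inter> A i) x - g x))\<^sup>2 \<partial>M) < e" by blast
  qed
  have appr_set: "\<forall>c. appr (\<lambda>x. c * indicator (X \<inter> A i) x)" if X: "X \<in> sets M" for X i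
    using Int G'sub X[unfolded sG']
  proof (induction rule: sigma_sets_induct_disjoint)
    case (basic X) then show ?case using appr_basic by blast
  next
    case empty then show ?case using appr_zero by simp
  next
    case (compl X)
    then have [measurable]: "X \<in> sets M" using sG' by simp
    have sp: "space M \<in> G'" unfolding G'_def by (rule image_eqI[of _ _ "{}"]) auto
    show ?case
    proof
      fix c
      have "appr (\<lambda>x. c * indicator (space M \<inter> A i) x + (- c) * indicator (X \<inter> A i) x)"
        using appr_add[OF appr_basic[OF sp]] compl by blast
      then show "appr (\<lambda>x. c * indicator ((space M - X) \<inter> A i) x)"
        by (rule appr_cong) (auto simp: indicator_def)
    qed
  next
    case (union B)
    then have [measurable]: "B j \<in> sets M" for j using sG' by auto
    show ?case
    proof
      fix c
      show "appr (\<lambda>x. c * indicator ((\<Union>j. B j) \<inter> A i) x)"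
      proof (rule appr_lim)
        show *: "square_integrable M (\<lambda>x. c * indicator ((\<Union>j. B j) \<inter> A i) x)" by (rule ind) measurable
        have eq: "(\<Sum>j<n. c * indicator (B j \<inter> A i) x) = c * indicator ((\<Union>j<n. B j) \<inter> A i) x" for n and x
        proof (induction n)
          case (Suc n)
          have "B n \<inter> B j = {}" if "j < n" for j
            using union(1) that by (intro disjoint_family_onD[of B UNIV]) auto
          then have "B n \<inter> (\<Union>j<n. B j) = {}" by blast
          moreover define U where "U = (\<Union>j<n. B j)"
          moreover have "(\<Union>j<Suc n. B j) = U \<union> B n" by (auto simp: U_def lessThan_Suc)
          ultimately have "c * indicator ((\<Union>j<Suc n. B j) \<inter> A i) x =
              c * indicator (U \<inter> A i) x + c * indicator (B n \<inter> A i) x"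
            by (cases "x \<in> U"; cases "x \<in> B n") (auto simp: indicator_def)
          then show ?case using Suc by (simp only: sum.lessThan_Suc U_def)
        qed simp
        have "appr (\<lambda>x. \<Sum>j<n. c * indicator (B j \<inter> A i) x)" for n
          using union(3) by (intro appr_sum) auto
        then show "appr (\<lambda>x. c * indicator ((\<Union>j<n. B j) \<inter> A i) x)" for n by (simp add: eq)
        show "(\<lambda>n. \<integral>x. (cmod (c * indicator ((\<Union>j. B j) \<inter> A i) x - c * indicator ((\<Union>j<n. B j) \<inter> A i) x))\<^sup>2 \<partial>M) \<longlonglongrightarrow> 0"
        proof (rule L2_dominated[OF *])
          fix x
          show "(\<lambda>n. c * indicator ((\<Union>j<n. B j) \<inter> A i) x) \<longlonglongrightarrow> c * indicator ((\<Union>j. B j) \<inter> A i) x"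
          proof (cases "x \<in> (\<Union>j. B j)")
            case True
            then obtain k where "x \<in> B k" by auto
            then have "\<forall>\<^sub>F n in sequentially. c * indicator ((\<Union>j<n. B j) \<inter> A i) x = c * indicator ((\<Union>j. B j) \<inter> A i) x"
              by (intro eventually_sequentiallyI[of "Suc k"]) (auto simp: indicator_def Suc_le_eq)
            then show ?thesis by (rule tendsto_eventually)
          qed auto
        qed (auto simp: indicator_def)
      qed
    qed
  qed
  have dense: "appr f" if f: "square_integrable M f" for f
  proof -
    have [measurable]: "f \<in> borel_measurable M" using f by (simp add: square_integrable_def)
    obtain F where F: "\<And>i. simple_function M (F i)" "\<And>x. x \<in> space M \<Longrightarrow> (\<lambda>i. F i x) \<longlonglongrightarrow> f x"
      "\<And>i x. x \<in> space M \<Longrightarrow> dist (F i x) 0 \<le> 2 * dist (f x) 0"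
      using borel_measurable_implies_sequence_metric[OF \<open>f \<in> borel_measurable M\<close>, of 0]
      by (elim exE conjE) (simp only: Ball_def; iprover)
    have [measurable]: "F i \<in> borel_measurable M" for i
      using F(1) by (rule borel_measurable_simple_function)
    show ?thesis
    proof (rule appr_lim[OF f])
      show "appr (\<lambda>x. F i x * indicator (A i) x)" for i
      proof (rule appr_cong)
        show "appr (\<lambda>x. \<Sum>y\<in>F i ` space M. y * indicator ((F i -` {y} \<inter> space M) \<inter> A i) x)"
          using F(1)[of i] by (intro appr_sum appr_set[rule_format]) (auto simp: simple_function_def)
        fix x assume x: "x \<in> space M"
        have "(\<Sum>y\<in>F i ` space M. y * indicator ((F i -` {y} \<inter> space M) \<inter> A i) x) =
            (\<Sum>y\<in>F i ` space M. if y = F i x then F i x * indicator (A i) x else 0)"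
          using x by (intro sum.cong) (auto simp: indicator_def)
        also have "\<dots> = F i x * indicator (A i) x"
          using x F(1)[of i] by (subst sum.delta) (auto simp: simple_function_def)
        finally show "(\<Sum>y\<in>F i ` space M. y * indicator ((F i -` {y} \<inter> space M) \<inter> A i) x) = F i x * indicator (A i) x" .
      qed measurable
      show "(\<lambda>i. \<integral>x. (cmod (f x - F i x * indicator (A i) x))\<^sup>2 \<partial>M) \<longlonglongrightarrow> 0"
      proof (rule L2_dominated[OF f])
        fix x assume x: "x \<in> space M"
        then obtain k where k: "x \<in> A k" using A(2) by auto
        have "\<forall>\<^sub>F i in sequentially. F i x = F i x * indicator (A i) x"
          using k A(4) by (intro eventually_sequentiallyI[of k]) (auto simp: incseq_def indicator_def)
        with F(2)[OF x] show "(\<lambda>i. F i x * indicator (A i) x) \<longlonglongrightarrow> f x"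
          by (rule Lim_transform_eventually)
        show "cmod (F i x * indicator (A i) x) \<le> 2 * cmod (f x)" for i
          using F(3)[OF x, of i] by (auto simp: indicator_def)
      qed measurable
    qed
  qed
  show ?thesis
  proof (rule that[of D])
    show "countable D" unfolding D_def P_def
      by (intro countable_image countable_lists countable_SIGMA Q cG') auto
    show "square_integrable M g" if "g \<in> D" for g using that hD by (auto simp: D_def)
    show "\<exists>g\<in>D. (\<integral>x. (cmod (f x - g x))\<^sup>2 \<partial>M) < e" if "square_integrable M f" "0 < e" for f e
      using dense[OF that(1)] that(2) by (simp add: appr_def)
  qed
qed

lemma sigma_finite_half_line: "sigma_finite_measure half_line"
  unfolding half_line_def
  by (intro sigma_finite_measure_restrict_space lborel.sigma_finite_measure_axioms) auto

interpretation half_line: sigma_finite_measure half_line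
  by (rule sigma_finite_half_line)

interpretation half_line_prod: product_sigma_finite "\<lambda>_::nat. half_line"
  by (simp add: product_sigma_finite_def sigma_finite_half_line)

lemma sigma_finite_power_space: "sigma_finite_measure (power_space n)"
  by (rule half_line_prod.sigma_finite) simp

lemma distr_power_space_permutes:
  assumes p: "p permutes {..<n}"
  shows "(\<lambda>x. x \<circ> p) \<in> measurable (power_space n) (power_space n)"
    and "distr (power_space n) (power_space n) (\<lambda>x. x \<circ> p) = power_space n"
proof -
  have pin: "p i < n \<longleftrightarrow> i < n" for i using permutes_in_image[OF p, of i] by simp
  have fixp: "p i = i" if "\<not> i < n" for i using p that by (auto simp: permutes_def)
  show meas[measurable]: "(\<lambda>x. x \<circ> p) \<in> measurable (power_space n) (power_space n)"
  proof (rule measurable_PiM_single')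
    show "(\<lambda>x. (x \<circ> p) i) \<in> measurable (power_space n) half_line" if "i \<in> {..<n}" for i
      using that pin by (auto intro!: measurable_component_singleton)
    show "(\<lambda>x. x \<circ> p) \<in> space (power_space n) \<rightarrow> (\<Pi>\<^sub>E i\<in>{..<n}. space half_line)"
      using pin fixp by (auto simp: space_PiM PiE_iff extensional_def)
  qed
  show "distr (power_space n) (power_space n) (\<lambda>x. x \<circ> p) = power_space n"
  proof (rule half_line_prod.PiM_eqI)
    fix A :: "nat \<Rightarrow> real set" assume A: "\<And>i. i \<in> {..<n} \<Longrightarrow> A i \<in> sets half_line"
    have inv: "inv p permutes {..<n}" by (rule permutes_inv[OF p])
    have "emeasure (distr (power_space n) (power_space n) (\<lambda>x. x \<circ> p)) (Pi\<^sub>E {..<n} A) =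
        emeasure (power_space n) ((\<lambda>x. x \<circ> p) -` (Pi\<^sub>E {..<n} A) \<inter> space (power_space n))"
      using A by (intro emeasure_distr sets_PiM_I_finite) auto
    also have "(\<lambda>x. x \<circ> p) -` (Pi\<^sub>E {..<n} A) \<inter> space (power_space n) = Pi\<^sub>E {..<n} (\<lambda>i. A (inv p i))"
    proof (intro set_eqI iffI)
      fix x assume x: "x \<in> (\<lambda>x. x \<circ> p) -` (Pi\<^sub>E {..<n} A) \<inter> space (power_space n)"
      have "x i \<in> A (inv p i)" if "i < n" for i
      proof -
        have "inv p i < n" using that permutes_in_image[OF inv, of i] by simp
        with x have "x (p (inv p i)) \<in> A (inv p i)" by (auto simp: PiE_iff)
        then show ?thesis using permutes_inverses(1)[OF p] by simp
      qed
      then show "x \<in> Pi\<^sub>E {..<n} (\<lambda>i. A (inv p i))" using x by (auto simp: space_PiM PiE_iff)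
    next
      fix x assume x: "x \<in> Pi\<^sub>E {..<n} (\<lambda>i. A (inv p i))"
      have "x (p i) \<in> A i" if "i < n" for i
      proof -
        have "p i < n" using that pin by simp
        with x have "x (p i) \<in> A (inv p (p i))" by (auto simp: PiE_iff)
        then show ?thesis using permutes_inverses(2)[OF p] by simp
      qed
      moreover have "x i \<in> space half_line" if "i < n" for i
      proof -
        have "inv p i \<in> {..<n}" using that permutes_in_image[OF inv, of i] by simp
        from sets.sets_into_space[OF A[OF this]] x that show ?thesis by (auto simp: PiE_iff)
      qed
      ultimately show "x \<in> (\<lambda>x. x \<circ> p) -` (Pi\<^sub>E {..<n} A) \<inter> space (power_space n)"
        using x pin fixp by (auto simp: space_PiM PiE_iff extensional_def)
    qed
    also have "emeasure (power_space n) (Pi\<^sub>E {..<n} (\<lambda>i. A (inv p i))) = (\<Prod>i<n. emeasure half_line (A (inv p i)))"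
      using A permutes_in_image[OF inv] by (intro half_line_prod.emeasure_PiM) auto
    also have "\<dots> = (\<Prod>i<n. emeasure half_line (A i))"
      using prod.permute[OF inv, of "\<lambda>i. emeasure half_line (A i)"] by (simp add: o_def)
    finally show "emeasure (distr (power_space n) (power_space n) (\<lambda>x. x \<circ> p)) (Pi\<^sub>E {..<n} A) =
        (\<Prod>i<n. emeasure half_line (A i))" .
  qed auto
qed

lemma power_space_countably_generated:
  obtains G where "countable G" "G \<subseteq> Pow (space (power_space n))"
    "sets (power_space n) = sigma_sets (space (power_space n)) G"
proof -
  obtain B :: "real set set" where B: "countable B" "topological_basis B" using ex_countable_basis by blast
  let ?\<Omega> = "space (power_space n)"
  define G where "G = (\<lambda>(i, b). {x \<in> ?\<Omega>. x i \<in> b}) ` ({..<n} \<times> B)"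
  define N where "N = sigma ?\<Omega> G"
  have G: "countable G" "G \<subseteq> Pow ?\<Omega>" using B by (auto simp: G_def)
  have spN: "space N = ?\<Omega>" and sN: "sets N = sigma_sets ?\<Omega> G"
    unfolding N_def using G by (auto simp: space_measure_of_conv sets_measure_of)
  have comp: "(\<lambda>x. x i) \<in> measurable N half_line" if i: "i < n" for i
    unfolding half_line_def
  proof (rule measurable_restrict_space2)
    show "(\<lambda>x. x i) \<in> space N \<rightarrow> {0..}"
      using i by (auto simp: spN space_PiM half_line_def PiE_iff)
    have "(\<lambda>x. x i) \<in> measurable N (sigma UNIV B)"
    proof (rule measurable_measure_of)
      show "(\<lambda>x. x i) -` b \<inter> space N \<in> sets N" if "b \<in> B" for b
      proof -
        have "(\<lambda>x. x i) -` b \<inter> space N = {x \<in> ?\<Omega>. x i \<in> b}" by (auto simp: spN)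
        also have "\<dots> \<in> G" unfolding G_def using i that by force
        finally show ?thesis unfolding sN by auto
      qed
    qed auto
    then show "(\<lambda>x. x i) \<in> measurable N lborel"
      by (simp add: borel_eq_countable_basis[OF B, symmetric])
  qed
  have "sets (power_space n) \<subseteq> sets N"
  proof -
    have "sets (power_space n) = sigma_sets ?\<Omega> {{f \<in> ?\<Omega>. f i \<in> A} | i A. i \<in> {..<n} \<and> A \<in> sets half_line}"
      by (subst sets_PiM_single) (simp add: space_PiM)
    also have "\<dots> \<subseteq> sets N"
    proof -
      have "{f \<in> ?\<Omega>. f i \<in> A} \<in> sets N" if "i < n" "A \<in> sets half_line" for i A
      proof -
        have "{f \<in> ?\<Omega>. f i \<in> A} = (\<lambda>x. x i) -` A \<inter> space N" by (auto simp: spN)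
        then show ?thesis using measurable_sets[OF comp[OF that(1)] that(2)] by simp
      qed
      then show ?thesis unfolding spN[symmetric]
        by (intro sets.sigma_sets_subset) (auto simp: spN)
    qed
    finally show ?thesis .
  qed
  moreover have "sets N \<subseteq> sets (power_space n)"
    unfolding sN
  proof (rule sets.sigma_sets_subset, rule subsetI)
    fix X assume "X \<in> G"
    then obtain i b where "i < n" "b \<in> B" and Xeq: "X = {x \<in> ?\<Omega>. x i \<in> b}" by (auto simp: G_def)
    have "b \<in> sets borel" using B(2) \<open>b \<in> B\<close> by (auto simp: topological_basis_open)
    then have "b \<inter> {0..} \<in> sets half_line" by (auto simp: half_line_def sets_restrict_space)
    then have "(\<lambda>x. x i) -` (b \<inter> {0..}) \<inter> ?\<Omega> \<in> sets (power_space n)"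
      using \<open>i < n\<close> by (intro measurable_sets[OF measurable_component_singleton]) auto
    also have "(\<lambda>x. x i) -` (b \<inter> {0..}) \<inter> ?\<Omega> = X"
    proof -
      have "x i \<in> {0..}" if "x \<in> ?\<Omega>" for x
        using that \<open>i < n\<close> by (auto simp: space_PiM half_line_def PiE_iff)
      then show ?thesis unfolding Xeq by blast
    qed
    finally show "X \<in> sets (power_space n)" .
  qed
  ultimately have "sets (power_space n) = sigma_sets ?\<Omega> G" unfolding sN[symmetric] by (rule antisym)
  with G show ?thesis by (rule that)
qed

definition sqd :: "(nat \<Rightarrow> (nat \<Rightarrow> real) \<Rightarrow> complex) \<Rightarrow> (nat \<Rightarrow> (nat \<Rightarrow> real) \<Rightarrow> complex) \<Rightarrow> nat \<Rightarrow> real" where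
  "sqd f g n = (\<integral>x. (cmod (f n x - g n x))\<^sup>2 \<partial>power_space n)"

lemma sqd_nonneg: "0 \<le> sqd f g n" by (simp add: sqd_def)

lemma fock_seq_diff: "fock_seq f \<Longrightarrow> fock_seq g \<Longrightarrow> fock_seq (\<lambda>n x. f n x - g n x)"
  using fock_seq_add[OF _ fock_seq_cmult[of g "-1"], of f] by simp

lemma sqd_summable: "fock_seq f \<Longrightarrow> fock_seq g \<Longrightarrow> summable (sqd f g)"
  using fock_seqD(3)[OF fock_seq_diff] by (simp add: sqd_def[abs_def])

lemma norm_fock_eq: "fock_seq f \<Longrightarrow> (norm (abs_fock f))\<^sup>2 = (\<Sum>n. \<integral>x. (cmod (f n x))\<^sup>2 \<partial>power_space n)"
  by (simp add: power2_norm_eq_inner inner_fock_def cinner.abs_eq fock_eq_refl cinner_self)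

lemma abs_fock_diff: "fock_seq f \<Longrightarrow> fock_seq g \<Longrightarrow> abs_fock f - abs_fock g = abs_fock (\<lambda>n x. f n x - g n x)"
  using fock_seq_cmult[of g "-1"]
  by (simp add: minus_fock_def uminus_fock_def scaleC.abs_eq plus_fock.abs_eq fock_eq_refl)

lemma dist_fock_sqd: "fock_seq f \<Longrightarrow> fock_seq g \<Longrightarrow> (dist (abs_fock f) (abs_fock g))\<^sup>2 = (\<Sum>n. sqd f g n)"
  by (simp add: dist_norm abs_fock_diff norm_fock_eq fock_seq_diff sqd_def[abs_def])

lemma fock_rep: "\<exists>f. fock_seq f \<and> x = abs_fock f"
proof (intro exI conjI)
  show "fock_seq (rep_fock x)"
    using Quotient_rep_reflp[OF Quotient_fock, of x] by (simp add: fock_eq_seq)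
  show "x = abs_fock (rep_fock x)"
    using Quotient_abs_rep[OF Quotient_fock, of x] by simp
qed

instance fock :: complete_space
proof
  fix X :: "nat \<Rightarrow> fock" assume X: "Cauchy X"
  have "\<forall>i. \<exists>f. fock_seq f \<and> X i = abs_fock f" using fock_rep by blast
  from choice[OF this] obtain F where F: "\<And>i. fock_seq (F i)" "\<And>i. X i = abs_fock (F i)" by blast
  have cau: "\<exists>N. \<forall>i\<ge>N. \<forall>j\<ge>N. (\<Sum>n. sqd (F i) (F j) n) < e" if e: "0 < e" for e
  proof -
    obtain N where N: "\<And>i j. i \<ge> N \<Longrightarrow> j \<ge> N \<Longrightarrow> dist (X i) (X j) < sqrt e"
      using X e unfolding Cauchy_def by (metis real_sqrt_gt_zero)
    have "(\<Sum>n. sqd (F i) (F j) n) < e" if "i \<ge> N" "j \<ge> N" for i j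
    proof -
      have "(dist (X i) (X j))\<^sup>2 < (sqrt e)\<^sup>2" using N[OF that] by (intro power_strict_mono) auto
      then show ?thesis using e F by (simp add: dist_fock_sqd)
    qed
    then show ?thesis by blast
  qed
  have le: "sum (sqd (F i) (F j)) S \<le> (\<Sum>n. sqd (F i) (F j) n)" if "finite S" for i j S
    using that by (intro sum_le_suminf sqd_summable F) (auto simp: sqd_nonneg)
  have "\<exists>f. square_integrable (power_space n) f \<and> (\<lambda>i. \<integral>x. (cmod (F i n x - f x))\<^sup>2 \<partial>power_space n) \<longlonglongrightarrow> 0" for n
  proof -
    interpret sigma_finite_measure "power_space n" by (rule sigma_finite_power_space)
    show ?thesis
    proof (rule L2_complete)
      show "square_integrable (power_space n) (F i n)" for i by (intro fock_seqD F)
      fix e :: real assume "0 < e"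
      from cau[OF this] obtain N where N: "\<forall>i\<ge>N. \<forall>j\<ge>N. (\<Sum>n. sqd (F i) (F j) n) < e" by blast
      have "(\<integral>x. (cmod (F i n x - F j n x))\<^sup>2 \<partial>power_space n) < e" if "i \<ge> N" "j \<ge> N" for i j
      proof -
        have "sqd (F i) (F j) n \<le> (\<Sum>n. sqd (F i) (F j) n)" using le[of "{n}" i j] by simp
        also have "\<dots> < e" using N that by blast
        finally show ?thesis by (simp add: sqd_def)
      qed
      then show "\<exists>N. \<forall>i\<ge>N. \<forall>j\<ge>N. (\<integral>x. (cmod (F i n x - F j n x))\<^sup>2 \<partial>power_space n) < e" by blast
    next
      fix f assume "square_integrable (power_space n) f" "(\<lambda>i. \<integral>x. (cmod (F i n x - f x))\<^sup>2 \<partial>power_space n) \<longlonglongrightarrow> 0"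
      then show ?thesis by blast
    qed
  qed
  then have "\<forall>n. \<exists>f. square_integrable (power_space n) f \<and> (\<lambda>i. \<integral>x. (cmod (F i n x - f x))\<^sup>2 \<partial>power_space n) \<longlonglongrightarrow> 0"
    by (rule allI)
  from choice[OF this] obtain f where
    f0: "\<forall>n. square_integrable (power_space n) (f n) \<and> (\<lambda>i. \<integral>x. (cmod (F i n x - f n x))\<^sup>2 \<partial>power_space n) \<longlonglongrightarrow> 0"
    by (elim exE)
  have f: "square_integrable (power_space n) (f n)" "(\<lambda>i. sqd (F i) f n) \<longlonglongrightarrow> 0" for n
    using f0 by (simp_all add: sqd_def)
  have si: "square_integrable (power_space n) (F i n)" for i n by (intro fock_seqD F)
  have tri: "sqd (F i) f n \<le> 2 * sqd (F i) (F j) n + 2 * sqd (F j) f n" for i j n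
    using integral_norm_add_sq_le[OF square_integrable_diff[OF si[where i=i] si[where i=j]] square_integrable_diff[OF si[where i=j] f(1)], of n]
    by (simp add: sqd_def)
  have key: "summable (sqd (F i) f) \<and> (\<Sum>n. sqd (F i) f n) \<le> 2 * e" if N: "\<forall>i\<ge>N. \<forall>j\<ge>N. (\<Sum>n. sqd (F i) (F j) n) < e" and i: "i \<ge> N" for N i e
  proof -
    have part: "sum (sqd (F i) f) {..<m} \<le> 2 * e" for m
    proof (rule LIMSEQ_le_const)
      show "(\<lambda>j. 2 * e + 2 * (\<Sum>n<m. sqd (F j) f n)) \<longlonglongrightarrow> 2 * e"
        using tendsto_add[OF tendsto_const[of "2 * e"] tendsto_mult[OF tendsto_const[of 2] tendsto_sum[of "{..<m}" "\<lambda>n j. sqd (F j) f n" "\<lambda>_. 0", OF f(2)]]]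
        by simp
      have "sum (sqd (F i) f) {..<m} \<le> 2 * e + 2 * (\<Sum>n<m. sqd (F j) f n)" if "j \<ge> N" for j
      proof -
        have "sum (sqd (F i) f) {..<m} \<le> (\<Sum>n<m. 2 * sqd (F i) (F j) n + 2 * sqd (F j) f n)"
          by (intro sum_mono tri)
        also have "\<dots> = 2 * sum (sqd (F i) (F j)) {..<m} + 2 * (\<Sum>n<m. sqd (F j) f n)"
          by (simp add: sum.distrib sum_distrib_left)
        also have "sum (sqd (F i) (F j)) {..<m} \<le> e"
        proof -
          have "sum (sqd (F i) (F j)) {..<m} \<le> (\<Sum>n. sqd (F i) (F j) n)" by (rule le) simp
          also have "\<dots> \<le> e" using N i that by (meson less_imp_le)
          finally show ?thesis .
        qed
        finally show ?thesis by simp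
      qed
      then show "\<exists>N. \<forall>j\<ge>N. sum (sqd (F i) f) {..<m} \<le> 2 * e + 2 * (\<Sum>n<m. sqd (F j) f n)" by blast
    qed
    have "summable (sqd (F i) f)"
      by (rule summableI_nonneg_bounded[OF sqd_nonneg part])
    moreover from this have "(\<Sum>n. sqd (F i) f n) \<le> 2 * e" by (rule suminf_le_const[OF _ part])
    ultimately show ?thesis by blast
  qed
  have ffock: "fock_seq f"
    unfolding fock_seq_def
  proof (intro conjI allI impI)
    show "square_integrable (power_space n) (f n)" for n by (rule f)
    obtain N where N: "\<forall>i\<ge>N. \<forall>j\<ge>N. (\<Sum>n. sqd (F i) (F j) n) < 1" using cau[of 1] by auto
    have sm: "summable (sqd (F N) f)" using key[OF N] by blast
    show "summable (\<lambda>n. \<integral>x. (cmod (f n x))\<^sup>2 \<partial>power_space n)"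
    proof (rule summable_comparison_test')
      show "summable (\<lambda>n. 2 * (\<integral>x. (cmod (F N n x))\<^sup>2 \<partial>power_space n) + 2 * sqd (F N) f n)"
        by (intro summable_add summable_mult fock_seqD F sm)
      fix n
      have "(\<integral>x. (cmod (F N n x + (f n x - F N n x)))\<^sup>2 \<partial>power_space n) \<le>
          2 * (\<integral>x. (cmod (F N n x))\<^sup>2 \<partial>power_space n) + 2 * (\<integral>x. (cmod (f n x - F N n x))\<^sup>2 \<partial>power_space n)"
        by (intro integral_norm_add_sq_le square_integrable_diff si f)
      then show "norm (\<integral>x. (cmod (f n x))\<^sup>2 \<partial>power_space n) \<le> 2 * (\<integral>x. (cmod (F N n x))\<^sup>2 \<partial>power_space n) + 2 * sqd (F N) f n"
        by (simp add: sqd_def norm_minus_commute)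
    qed
    fix n :: nat and p :: "nat \<Rightarrow> nat" assume p: "p permutes {..<n}"
    note dp = distr_power_space_permutes[OF p]
    note [measurable] = dp(1)
    have [measurable]: "f n \<in> borel_measurable (power_space n)" "F i n \<in> borel_measurable (power_space n)" for i
      using f(1)[of n] si[of n i] by (auto simp: square_integrable_def)
    have trans: "(\<integral>x. h (x \<circ> p) \<partial>power_space n) = (\<integral>x. h x \<partial>power_space n)"
      if [measurable]: "h \<in> borel_measurable (power_space n)" for h :: "_ \<Rightarrow> real"
      using integral_distr[OF dp(1) that] by (simp add: dp(2))
    have transi: "integrable (power_space n) (\<lambda>x. h (x \<circ> p)) \<longleftrightarrow> integrable (power_space n) h"
      if [measurable]: "h \<in> borel_measurable (power_space n)" for h :: "_ \<Rightarrow> real"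
      using integrable_distr_eq[OF dp(1) that] by (simp add: dp(2))
    have sqp: "square_integrable (power_space n) (\<lambda>x. h (x \<circ> p))" if "square_integrable (power_space n) h" for h :: "_ \<Rightarrow> complex"
    proof -
      have [measurable]: "h \<in> borel_measurable (power_space n)" using that by (simp add: square_integrable_def)
      show ?thesis using that transi[of "\<lambda>x. (cmod (h x))\<^sup>2"] by (simp add: square_integrable_def)
    qed
    define f' where "f' = (\<lambda>x. f n (x \<circ> p))"
    define F' where "F' i = (\<lambda>x. F i n (x \<circ> p))" for i
    have sf': "square_integrable (power_space n) f'" and sF': "square_integrable (power_space n) (F' i)" for i
      unfolding f'_def F'_def by (intro sqp f si)+
    then have [measurable]: "f' \<in> borel_measurable (power_space n)" "F' i \<in> borel_measurable (power_space n)" for i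
      by (simp_all add: square_integrable_def)
    have 1: "(\<integral>x. (cmod (f' x - f n x))\<^sup>2 \<partial>power_space n) \<le> 4 * sqd (F i) f n" for i
    proof -
      have AE: "AE x in power_space n. F' i x = F i n x"
        unfolding F'_def by (rule fock_seqD(2)[OF F(1) p])
      have "(\<integral>x. (cmod (f' x - f n x))\<^sup>2 \<partial>power_space n) =
          (\<integral>x. (cmod ((f' x - F' i x) + (F i n x - f n x)))\<^sup>2 \<partial>power_space n)"
      proof (rule integral_cong_AE)
        show "AE x in power_space n. (cmod (f' x - f n x))\<^sup>2 = (cmod ((f' x - F' i x) + (F i n x - f n x)))\<^sup>2"
          using AE by eventually_elim simp
      qed measurable
      also have "\<dots> \<le> 2 * (\<integral>x. (cmod (f' x - F' i x))\<^sup>2 \<partial>power_space n) + 2 * sqd (F i) f n"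
        unfolding sqd_def by (intro integral_norm_add_sq_le square_integrable_diff sf' sF' si f)
      also have "(\<integral>x. (cmod (f' x - F' i x))\<^sup>2 \<partial>power_space n) = (\<integral>x. (cmod (f n x - F i n x))\<^sup>2 \<partial>power_space n)"
        unfolding f'_def F'_def by (rule trans) measurable
      also have "\<dots> = sqd (F i) f n" by (simp add: sqd_def norm_minus_commute)
      finally show ?thesis by simp
    qed
    have "(\<lambda>i. 4 * sqd (F i) f n) \<longlonglongrightarrow> 0"
      using tendsto_mult_right_zero[OF f(2), of 4] by simp
    then have "(\<integral>x. (cmod (f' x - f n x))\<^sup>2 \<partial>power_space n) \<le> 0"
      by (rule LIMSEQ_le_const) (use 1 in blast)
    then have 0: "(\<integral>x. (cmod (f' x - f n x))\<^sup>2 \<partial>power_space n) = 0"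
      by (intro antisym integral_nonneg_AE) auto
    have int: "integrable (power_space n) (\<lambda>x. (cmod (f' x - f n x))\<^sup>2)"
      using square_integrable_diff[OF sf' f(1)] by (simp add: square_integrable_def)
    have "AE x in power_space n. (cmod (f' x - f n x))\<^sup>2 = 0"
      using 0 integral_nonneg_eq_0_iff_AE[OF int] by simp
    then show "AE x in power_space n. f n (x \<circ> p) = f n x"
      unfolding f'_def by eventually_elim simp
  qed
  have "X \<longlonglongrightarrow> abs_fock f"
  proof (rule metric_LIMSEQ_I)
    fix r :: real assume r: "0 < r"
    then have "0 < r\<^sup>2 / 4" by simp
    from cau[OF this] obtain N where N: "\<forall>i\<ge>N. \<forall>j\<ge>N. (\<Sum>n. sqd (F i) (F j) n) < r\<^sup>2 / 4" by blast
    have "dist (X i) (abs_fock f) < r" if "i \<ge> N" for i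
    proof -
      have "(dist (X i) (abs_fock f))\<^sup>2 \<le> 2 * (r\<^sup>2 / 4)"
        using key[OF N that] F ffock by (simp add: dist_fock_sqd)
      also have "\<dots> < r\<^sup>2" using r by simp
      finally show ?thesis by (rule power2_less_imp_less) (use r in simp)
    qed
    then show "\<exists>no. \<forall>n\<ge>no. dist (X n) (abs_fock f) < r" by blast
  qed
  then show "convergent X" by (rule convergentI)
qed

instance fock :: banach ..

lemma fock_countable_approx:
  obtains P :: "(nat \<Rightarrow> (nat \<Rightarrow> real) \<Rightarrow> complex) set" where "countable P"
    "\<And>p n. p \<in> P \<Longrightarrow> square_integrable (power_space n) (p n)"
    "\<And>f e. fock_seq f \<Longrightarrow> 0 < e \<Longrightarrow> \<exists>p\<in>P. summable (sqd f p) \<and> (\<Sum>n. sqd f p n) < e"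
proof -
  have "\<exists>D. countable D \<and> (\<forall>g\<in>D. square_integrable (power_space n) g) \<and>
     (\<forall>f e. square_integrable (power_space n) f \<longrightarrow> 0 < e \<longrightarrow> (\<exists>g\<in>D. (\<integral>x. (cmod (f x - g x))\<^sup>2 \<partial>power_space n) < e))" for n
  proof -
    interpret sigma_finite_measure "power_space n" by (rule sigma_finite_power_space)
    obtain G where G: "countable G" "G \<subseteq> Pow (space (power_space n))"
      "sets (power_space n) = sigma_sets (space (power_space n)) G"
      by (rule power_space_countably_generated)
    show ?thesis by (rule L2_separable[OF G]) blast
  qed
  then have "\<forall>n. \<exists>D. countable D \<and> (\<forall>g\<in>D. square_integrable (power_space n) g) \<and>
     (\<forall>f e. square_integrable (power_space n) f \<longrightarrow> 0 < e \<longrightarrow> (\<exists>g\<in>D. (\<integral>x. (cmod (f x - g x))\<^sup>2 \<partial>power_space n) < e))"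
    by (rule allI)
  from choice[OF this] obtain D where D0: "\<forall>n. countable (D n) \<and> (\<forall>g\<in>D n. square_integrable (power_space n) g) \<and>
     (\<forall>f e. square_integrable (power_space n) f \<longrightarrow> 0 < e \<longrightarrow> (\<exists>g\<in>D n. (\<integral>x. (cmod (f x - g x))\<^sup>2 \<partial>power_space n) < e))"
    by (elim exE)
  then have D: "countable (D n)" "g \<in> D n \<Longrightarrow> square_integrable (power_space n) g"
    "square_integrable (power_space n) f \<Longrightarrow> 0 < e \<Longrightarrow> \<exists>g\<in>D n. (\<integral>x. (cmod (f x - g x))\<^sup>2 \<partial>power_space n) < e" for n g f e
    by blast+
  define L where "L = {l \<in> lists (\<Union>n. D n). \<forall>n<length l. l ! n \<in> D n}"
  define q where "q = (\<lambda>l n (x::nat \<Rightarrow> real). if n < length l then (l ! n) x else (0::complex))"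
  have "countable (lists (\<Union>n. D n))" using D(1) by (intro countable_lists countable_UN) auto
  then have "countable L" by (rule countable_subset[rotated]) (auto simp: L_def)
  then have "countable (q ` L)" by (rule countable_image)
  moreover have "square_integrable (power_space n) (p n)" if "p \<in> q ` L" for p n
  proof -
    from that obtain l where l: "l \<in> L" "p = q l" by blast
    show ?thesis
    proof (cases "n < length l")
      case True
      then have "l ! n \<in> D n" using l by (auto simp: L_def)
      then show ?thesis using D(2) True by (simp add: l q_def)
    qed (simp add: l q_def square_integrable_zero)
  qed
  moreover have "\<exists>p\<in>q ` L. summable (sqd f p) \<and> (\<Sum>n. sqd f p n) < e" if f: "fock_seq f" and e: "0 < e" for f e
  proof -
    define a where "a n = (\<integral>x. (cmod (f n x))\<^sup>2 \<partial>power_space n)" for n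
    have sa: "summable a" using fock_seqD(3)[OF f] by (simp add: a_def[abs_def])
    obtain N where N: "norm (\<Sum>i. a (i + N)) < e / 2"
      using suminf_exist_split[OF _ sa, of "e/2"] e by auto
    have "\<forall>n. \<exists>g. g \<in> D n \<and> (\<integral>x. (cmod (f n x - g x))\<^sup>2 \<partial>power_space n) < e / (2 * (N + 1))"
      using D(3)[OF fock_seqD(1)[OF f], of "e / (2 * (N + 1))"] e by (simp add: Bex_def)
    from choice[OF this] obtain g where g: "\<forall>n. g n \<in> D n \<and> (\<integral>x. (cmod (f n x - g n x))\<^sup>2 \<partial>power_space n) < e / (2 * (N + 1))"
      by (elim exE)
    define l where "l = map g [0..<N]"
    have gD: "g n \<in> D n" for n using g by blast
    then have "set l \<subseteq> (\<Union>n. D n)" by (auto simp: l_def)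
    then have l: "l \<in> L" using gD by (auto simp: L_def l_def in_lists_conv_set)
    have s1: "sqd f (q l) n = (\<integral>x. (cmod (f n x - g n x))\<^sup>2 \<partial>power_space n)" if "n < N" for n
      using that by (simp add: sqd_def q_def l_def)
    have s2: "sqd f (q l) (n + N) = a (n + N)" for n
      by (simp add: sqd_def q_def l_def a_def)
    have sm': "summable (\<lambda>n. sqd f (q l) (n + N))" unfolding s2 using sa by (simp add: summable_iff_shift)
    then have sm: "summable (sqd f (q l))" by (simp add: summable_iff_shift)
    have "(\<Sum>n. sqd f (q l) n) = (\<Sum>n. sqd f (q l) (n + N)) + sum (sqd f (q l)) {..<N}"
      by (rule suminf_split_initial_segment[OF sm])
    also have "(\<Sum>n. sqd f (q l) (n + N)) < e / 2" using N by (simp add: s2)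
    also have "sum (sqd f (q l)) {..<N} \<le> (\<Sum>n<N. e / (2 * (N + 1)))"
      using g by (intro sum_mono) (simp add: s1 less_imp_le)
    also have "\<dots> \<le> e / 2" using e by (simp add: field_simps)
    finally have "(\<Sum>n. sqd f (q l) n) < e" by simp
    with sm l show ?thesis by blast
  qed
  ultimately show ?thesis by (rule that)
qed

instance fock :: second_countable_topology
proof
  obtain P :: "(nat \<Rightarrow> (nat \<Rightarrow> real) \<Rightarrow> complex) set" where P: "countable P"
    "\<And>p n. p \<in> P \<Longrightarrow> square_integrable (power_space n) (p n)"
    "\<And>f e. fock_seq f \<Longrightarrow> 0 < e \<Longrightarrow> \<exists>p\<in>P. summable (sqd f p) \<and> (\<Sum>n. sqd f p n) < e"
    by (rule fock_countable_approx) blast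
  define near where "near p k f \<longleftrightarrow> fock_seq f \<and> summable (sqd f p) \<and> (\<Sum>n. sqd f p n) < inverse (real (Suc k))" for p k f
  define h where "h = (\<lambda>(p, k). abs_fock (SOME f. near p k f))"
  define E where "E = h ` (P \<times> UNIV)"
  have cE: "countable E" unfolding E_def by (intro countable_image countable_SIGMA P) auto
  have dense: "\<exists>d\<in>E. dist x d < e" if e: "0 < e" for x :: fock and e
  proof -
    obtain f where f: "fock_seq f" "x = abs_fock f" using fock_rep by blast
    have "0 < e\<^sup>2 / 4" using e by simp
    then obtain k where k: "inverse (real (Suc k)) < e\<^sup>2 / 4" by (rule reals_Archimedean[THEN exE])
    obtain p where p: "p \<in> P" "summable (sqd f p)" "(\<Sum>n. sqd f p n) < inverse (real (Suc k))"
      using P(3)[OF f(1), of "inverse (real (Suc k))"] by auto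
    define g where "g = (SOME f. near p k f)"
    have "near p k f" using p f by (simp add: near_def)
    then have "near p k g" unfolding g_def by (rule someI[of "near p k"])
    then have g: "fock_seq g" "summable (sqd g p)" "(\<Sum>n. sqd g p n) < inverse (real (Suc k))"
      by (auto simp: near_def)
    have tri: "sqd f g n \<le> 2 * sqd f p n + 2 * sqd g p n" for n
    proof -
      have "(\<integral>x. (cmod ((f n x - p n x) + (p n x - g n x)))\<^sup>2 \<partial>power_space n) \<le>
        2 * (\<integral>x. (cmod (f n x - p n x))\<^sup>2 \<partial>power_space n) + 2 * (\<integral>x. (cmod (p n x - g n x))\<^sup>2 \<partial>power_space n)"
        by (intro integral_norm_add_sq_le square_integrable_diff fock_seqD(1) f g P(2)[OF p(1)])
      then show ?thesis by (simp add: sqd_def norm_minus_commute)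
    qed
    have "(dist x (abs_fock g))\<^sup>2 = (\<Sum>n. sqd f g n)" using f g by (simp add: dist_fock_sqd)
    also have "\<dots> \<le> (\<Sum>n. 2 * sqd f p n + 2 * sqd g p n)"
      by (intro suminf_le tri sqd_summable f g summable_add summable_mult p)
    also have "\<dots> = 2 * (\<Sum>n. sqd f p n) + 2 * (\<Sum>n. sqd g p n)"
      using p g by (simp add: suminf_add[symmetric] summable_mult suminf_mult)
    also have "\<dots> < e\<^sup>2" using p(3) g(3) k by linarith
    finally have "dist x (abs_fock g) < e" by (rule power2_less_imp_less) (use e in simp)
    moreover have "abs_fock g \<in> E" unfolding E_def h_def g_def using p(1) by force
    ultimately show ?thesis by blast
  qed
  define B where "B = (\<lambda>(d, m). ball d (inverse (real (Suc m)))) ` (E \<times> UNIV)"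
  have "countable B" unfolding B_def by (intro countable_image countable_SIGMA cE) auto
  moreover have "topological_basis B"
  proof (rule topological_basisI)
    show "open U" if "U \<in> B" for U using that by (auto simp: B_def)
    fix U and x :: fock assume "open U" "x \<in> U"
    then obtain r where r: "0 < r" "ball x r \<subseteq> U" by (meson openE)
    then have "0 < r / 2" by simp
    then obtain m where m: "inverse (real (Suc m)) < r / 2" by (rule reals_Archimedean[THEN exE])
    obtain d where d: "d \<in> E" "dist x d < inverse (real (Suc m))"
      using dense[of "inverse (real (Suc m))" x] by auto
    have "ball d (inverse (real (Suc m))) \<subseteq> U"
    proof
      fix y assume "y \<in> ball d (inverse (real (Suc m)))"
      then have "dist d y < inverse (real (Suc m))" by simp
      with d(2) m dist_triangle[of x y d] have "dist x y < r" by linarith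
      then show "y \<in> U" using r by auto
    qed
    moreover have "x \<in> ball d (inverse (real (Suc m)))" using d(2) by (simp add: dist_commute)
    moreover have "ball d (inverse (real (Suc m))) \<in> B" unfolding B_def using d(1) by force
    ultimately show "\<exists>B'\<in>B. x \<in> B' \<and> B' \<subseteq> U" by blast
  qed
  ultimately show "\<exists>B::fock set set. countable B \<and> open = generate_topology B"
    using topological_basis_imp_subbasis by blast
qed

lemma fock_seq_exp:
  assumes k: "square_integrable half_line k"
  shows "fock_seq (\<lambda>n x. (\<Prod>i<n. k (x i)) / of_real (sqrt (fact n)))"
  unfolding fock_seq_def
proof (intro conjI allI impI)
  have [measurable]: "k \<in> borel_measurable half_line" and int: "integrable half_line (\<lambda>t. (cmod (k t))\<^sup>2)"
    using k by (auto simp: square_integrable_def)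
  have sq: "(cmod ((\<Prod>i<n. k (x i)) / of_real (sqrt (fact n))))\<^sup>2 = (\<Prod>i<n. (cmod (k (x i)))\<^sup>2) / fact n" for n x
    by (simp add: norm_divide prod_norm[symmetric] power_divide prod_power_distrib)
  have i: "integrable (power_space n) (\<lambda>x. \<Prod>i<n. (cmod (k (x i)))\<^sup>2)" for n
    by (rule half_line_prod.product_integrable_prod) (simp_all add: int)
  show "square_integrable (power_space n) (\<lambda>x. (\<Prod>i<n. k (x i)) / of_real (sqrt (fact n)))" for n
    unfolding square_integrable_def sq using i[of n] by (auto intro!: borel_measurable_divide borel_measurable_prod)
  have "(\<integral>x. (cmod ((\<Prod>i<n. k (x i)) / of_real (sqrt (fact n))))\<^sup>2 \<partial>power_space n) =
      inverse (fact n) * (\<integral>t. (cmod (k t))\<^sup>2 \<partial>half_line) ^ n" for n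
    unfolding sq using half_line_prod.product_integral_prod[of "{..<n}" "\<lambda>_ t. (cmod (k t))\<^sup>2"]
    by (simp add: int field_simps)
  then show "summable (\<lambda>n. \<integral>x. (cmod ((\<Prod>i<n. k (x i)) / of_real (sqrt (fact n))))\<^sup>2 \<partial>power_space n)"
    using summable_exp[of "\<integral>t. (cmod (k t))\<^sup>2 \<partial>half_line"] by simp
  show "AE x in power_space n. (\<Prod>i<n. k ((x \<circ> p) i)) / of_real (sqrt (fact n)) = (\<Prod>i<n. k (x i)) / of_real (sqrt (fact n))"
    if "p permutes {..<n}" for n p
  proof (rule AE_I2)
    fix x
    have "(\<Prod>i<n. k ((x \<circ> p) i)) = (\<Prod>i<n. k (x i))"
      using prod.permute[OF that, of "\<lambda>i. k (x i)"] by (simp add: o_def)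
    then show "(\<Prod>i<n. k ((x \<circ> p) i)) / of_real (sqrt (fact n)) = (\<Prod>i<n. k (x i)) / of_real (sqrt (fact n))" by simp
  qed
qed

text \<open>The exponential vector \<open>\<Sum>\<^sub>n k\<^bsup>\<otimes>n\<^esup> / \<surd>n!\<close>; only meaningful for square-integrable \<open>k\<close>.\<close>

lift_definition exp_vec :: "(real \<Rightarrow> complex) \<Rightarrow> fock" is
  "\<lambda>k n x. if square_integrable half_line k then (\<Prod>i<n. k (x i)) / of_real (sqrt (fact n)) else 0"
proof (rule fock_eq_refl)
  show "fock_seq (\<lambda>n x. if square_integrable half_line k then (\<Prod>i<n. k (x i)) / of_real (sqrt (fact n)) else 0)" for k
    by (cases "square_integrable half_line k") (simp_all add: fock_seq_exp fock_seq_zero)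
qed

lemma norm_scaleC: "norm (scaleC c x) = cmod c * norm x"
proof -
  have "cinner (scaleC c x) (scaleC c x) = of_real ((cmod c)\<^sup>2) * cinner x x"
    by (subst cinner_scaleC_right, subst cinner_commute, subst cinner_scaleC_right)
       (simp add: complex_norm_square cinner_commute[of x x, symmetric] mult_ac del: of_real_power)
  then have "inner (scaleC c x) (scaleC c x) = (cmod c)\<^sup>2 * inner x x"
    by (simp add: inner_fock_def)
  then show ?thesis by (simp add: norm_eq_sqrt_inner real_sqrt_mult)
qed

lemma bounded_linear_scaleC: "bounded_linear (scaleC c)"
proof (rule bounded_linear_intro)
  show "scaleC c (x + y) = scaleC c x + scaleC c y" for x y by (rule scaleC_simps)
  show "scaleC c (r *\<^sub>R x) = r *\<^sub>R scaleC c x" for r x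
    by (simp add: scaleR_fock_def scaleC_simps mult.commute)
  show "norm (scaleC c x) \<le> norm x * cmod c" for x by (simp add: norm_scaleC)
qed

definition op_scaleC :: "complex \<Rightarrow> (fock \<Rightarrow>\<^sub>L fock) \<Rightarrow> (fock \<Rightarrow>\<^sub>L fock)" where
  "op_scaleC c T = Blinfun (\<lambda>x. scaleC c (T x))"

lemma op_scaleC_apply: "blinfun_apply (op_scaleC c T) x = scaleC c (T x)"
  unfolding op_scaleC_def
  by (subst bounded_linear_Blinfun_apply)
     (auto intro: bounded_linear_compose[OF bounded_linear_scaleC blinfun.bounded_linear_right])

lemma cinner_exp_vec:
  assumes k: "square_integrable half_line k" and l: "square_integrable half_line l"
  shows "cinner (exp_vec k) (exp_vec l) = exp (\<integral>t. cnj (k t) * l t \<partial>half_line)"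
proof -
  let ?E = "\<lambda>k n x. (\<Prod>i<n. k (x i)) / complex_of_real (sqrt (fact n))"
  have sq: "complex_of_real (sqrt (fact n)) * complex_of_real (sqrt (fact n)) = fact n" for n
    by (simp flip: of_real_mult)
  have "(\<integral>x. cnj (?E k n x) * ?E l n x \<partial>power_space n) =
      (\<integral>t. cnj (k t) * l t \<partial>half_line) ^ n /\<^sub>R fact n" for n
  proof -
    have "(\<integral>x. cnj (?E k n x) * ?E l n x \<partial>power_space n) =
        (\<integral>x. (\<Prod>i<n. cnj (k (x i)) * l (x i)) / fact n \<partial>power_space n)"
      by (simp add: prod.distrib sq)
    also have "\<dots> = (\<integral>x. (\<Prod>i<n. cnj (k (x i)) * l (x i)) \<partial>power_space n) / fact n"
      by simp
    also have "(\<integral>x. (\<Prod>i<n. cnj (k (x i)) * l (x i)) \<partial>power_space n) = (\<integral>t. cnj (k t) * l t \<partial>half_line) ^ n"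
      using half_line_prod.product_integral_prod[of "{..<n}" "\<lambda>_ t. cnj (k t) * l t"]
      by (simp add: integrable_cnj_mult[OF k l])
    finally show ?thesis by (simp add: scaleR_conv_of_real field_simps)
  qed
  then show ?thesis
    by (transfer fixing: k l) (simp add: k l exp_def)
qed

text \<open>The bounded complex-linear operators on the Fock space, among the bounded real-linear ones.\<close>

definition fock_operators :: "(fock \<Rightarrow>\<^sub>L fock) set" where
  "fock_operators = {T. \<forall>c x. blinfun_apply T (scaleC c x) = scaleC c (blinfun_apply T x)}"

definition square_integrable_process :: "(real \<Rightarrow> fock \<Rightarrow>\<^sub>L fock) \<Rightarrow> bool" where
  "square_integrable_process F \<longleftrightarrow> square_integrable half_line F \<and> (\<forall>t\<ge>0. F t \<in> fock_operators)"

text \<open>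
  \<open>has_divergence X M\<close> means that \<open>X\<close> lies in the domain of the divergence operator \<open>\<delta>\<close> and
  \<open>\<delta>(X) = M\<close>.
\<close>

definition has_divergence ::
    "(real \<Rightarrow> fock \<Rightarrow>\<^sub>L fock) \<times> (real \<Rightarrow> fock \<Rightarrow>\<^sub>L fock) \<Rightarrow> (fock \<Rightarrow>\<^sub>L fock) \<Rightarrow> bool" where
  "has_divergence X M \<longleftrightarrow>
     square_integrable_process (fst X) \<and> square_integrable_process (snd X) \<and> M \<in> fock_operators \<and>
     (\<forall>k1 k2. square_integrable half_line k1 \<longrightarrow> square_integrable half_line k2 \<longrightarrow>
        cinner (exp_vec k1) (M (exp_vec k2)) =
        (\<integral>t. \<i> * (k2 t - cnj (k1 t)) * cinner (exp_vec k1) (fst X t (exp_vec k2))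
            + (cnj (k1 t) + k2 t) * cinner (exp_vec k1) (snd X t (exp_vec k2)) \<partial>half_line))"

definition exp_span :: "fock set" where
  "exp_span = {\<Sum>j<m. scaleC (c j) (exp_vec (k j)) | (m::nat) c k.
     \<forall>j<m. square_integrable half_line (k j)}"

definition exp_gradient :: "(fock \<times> (real \<Rightarrow> fock)) set" where
  "exp_gradient = {(\<Sum>j<m. scaleC (c j) (exp_vec (k j)), \<lambda>t. \<Sum>j<m. scaleC (c j * k j t) (exp_vec (k j))) | (m::nat) c k.
     \<forall>j<m. square_integrable half_line (k j)}"

text \<open>
  The graph of the closed gradient: the closure, in the direct sum of the Fock space and
  \<open>L\<^sup>2(\<real>\<^sub>+; fock)\<close>, of the linear span of the pairs \<open>(\<E>(k), t \<mapsto> k(t) \<E>(k))\<close>. Elements of the \<open>L\<^sup>2\<close> space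
  are given by all of their representatives.
\<close>

definition malliavin_gradient :: "(fock \<times> (real \<Rightarrow> fock)) set" where
  "malliavin_gradient = {(\<psi>, u). square_integrable half_line u \<and>
     (\<exists>\<psi>s us. (\<forall>n. (\<psi>s n, us n) \<in> exp_gradient) \<and> \<psi>s \<longlonglongrightarrow> \<psi> \<and>
        (\<lambda>n. \<integral>\<^sup>+t. ennreal ((norm (us n t - u t))\<^sup>2) \<partial>half_line) \<longlonglongrightarrow> 0)}"

text \<open>The graph of the Hilbert space adjoint of the gradient.\<close>

definition skorohod_divergence :: "((real \<Rightarrow> fock) \<times> fock) set" where
  "skorohod_divergence = {(v, \<phi>). square_integrable half_line v \<and>
     (\<forall>(\<psi>, u) \<in> malliavin_gradient. (\<integral>t. cinner (u t) (v t) \<partial>half_line) = cinner \<psi> \<phi>)}"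

text \<open>
  For both integrals, \<open>\<psi>\<close> lies in the domain of the integral of \<open>F\<close> and \<open>\<phi>\<close> is the value there.
\<close>

definition has_annihilation_integral :: "(real \<Rightarrow> fock \<Rightarrow>\<^sub>L fock) \<Rightarrow> fock \<Rightarrow> fock \<Rightarrow> bool" where
  "has_annihilation_integral F \<psi> \<phi> \<longleftrightarrow>
     (\<exists>u. (\<psi>, u) \<in> malliavin_gradient \<and> has_bochner_integral half_line (\<lambda>t. F t (u t)) \<phi>)"

definition has_creation_integral :: "(real \<Rightarrow> fock \<Rightarrow>\<^sub>L fock) \<Rightarrow> fock \<Rightarrow> fock \<Rightarrow> bool" where
  "has_creation_integral F \<psi> \<phi> \<longleftrightarrow> ((\<lambda>t. F t \<psi>), \<phi>) \<in> skorohod_divergence"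

end

theory Submission
  imports Defs
begin

text \<open>
  Write \<open>F\<^sub>\<plusminus> = X\<^sup>2 \<plusminus> i X\<^sup>1\<close>. Collecting the coefficients of \<open>k\<^sub>2\<close> and of the conjugate of
  \<open>k\<^sub>1\<close> in the identity defining \<open>\<delta>(X) = M\<close> gives
  \<open>\<integral> \<langle>k\<^sub>1(t) \<E>(k\<^sub>1), F\<^sub>-(t) \<E>(k\<^sub>2)\<rangle> dt = \<langle>\<E>(k\<^sub>1), M \<E>(k\<^sub>2) - \<integral> k\<^sub>2(t) F\<^sub>+(t) \<E>(k\<^sub>2) dt\<rangle>\<close>.
  By sesquilinearity, for every \<open>\<psi>\<close> in the exponential span, \<open>M \<psi>\<close> minus the annihilation integral
  of \<open>F\<^sub>+\<close> satisfies the relation defining \<open>D\<^sup>*(F\<^sub>- \<psi>)\<close> against the span of the exponential vectors;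
  both sides are continuous for the graph norm, so it holds on the whole domain of the closed gradient.
\<close>

section \<open>Square-integrable functions with values in normed spaces\<close>

lemma square_integrable_bounded_linear:
  assumes T: "bounded_linear T" and f: "square_integrable M f"
  shows "square_integrable M (\<lambda>x. T (f x))"
proof -
  obtain K where K: "\<And>x. norm (T x) \<le> norm x * K" "0 < K"
    using bounded_linear.pos_bounded[OF T] by blast
  have [measurable]: "f \<in> borel_measurable M" "T \<in> borel_measurable borel"
    using f T by (auto simp: square_integrable_def linear_continuous_on
        intro!: borel_measurable_continuous_onI)
  have "integrable M (\<lambda>x. (norm (f x))\<^sup>2 * K\<^sup>2)"
    using f by (simp add: square_integrable_def)
  then have "integrable M (\<lambda>x. (norm (T (f x)))\<^sup>2)"
  proof (rule Bochner_Integration.integrable_bound)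
    show "AE x in M. norm ((norm (T (f x)))\<^sup>2) \<le> norm ((norm (f x))\<^sup>2 * K\<^sup>2)"
      using power_mono[OF K(1) norm_ge_zero, where n = 2] by (intro AE_I2) (simp add: power_mult_distrib)
  qed measurable
  then show ?thesis by (simp add: square_integrable_def)
qed

lemma square_integrable_add_vector:
  fixes f g :: "'a \<Rightarrow> 'b::{real_normed_vector, second_countable_topology}"
  assumes "square_integrable M f" "square_integrable M g"
  shows "square_integrable M (\<lambda>x. f x + g x)"
proof -
  have [measurable]: "f \<in> borel_measurable M" "g \<in> borel_measurable M"
    using assms by (auto simp: square_integrable_def)
  have "integrable M (\<lambda>x. 2 * (norm (f x))\<^sup>2 + 2 * (norm (g x))\<^sup>2)"
    using assms by (auto simp: square_integrable_def)
  then have "integrable M (\<lambda>x. (norm (f x + g x))\<^sup>2)"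
    by (rule Bochner_Integration.integrable_bound) (auto intro!: AE_I2 norm_add_sq)
  then show ?thesis by (simp add: square_integrable_def)
qed

lemma square_integrable_diff_vector:
  fixes f g :: "'a \<Rightarrow> 'b::{real_normed_vector, second_countable_topology}"
  assumes "square_integrable M f" "square_integrable M g"
  shows "square_integrable M (\<lambda>x. f x - g x)"
  using square_integrable_add_vector[OF assms(1),
      OF square_integrable_bounded_linear[OF bounded_linear_minus[OF bounded_linear_ident] assms(2)]]
  by simp

lemma square_integrable_sum_vector:
  fixes f :: "'i \<Rightarrow> 'a \<Rightarrow> 'b::{real_normed_vector, second_countable_topology}"
  assumes "\<And>i. i \<in> I \<Longrightarrow> square_integrable M (f i)"
  shows "square_integrable M (\<lambda>x. \<Sum>i\<in>I. f i x)"
  using assms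
proof (induction I rule: infinite_finite_induct)
  case (insert i I)
  then show ?case by (simp add: square_integrable_add_vector)
qed (simp_all add: square_integrable_def)

text \<open>The weighted inequality a b \<le> s a^2 + b^2 / s stands in for Cauchy-Schwarz:
  optimising \<open>s\<close> later makes the bound small when only \<open>f\<close> is small.
  \<open>K\<close> is kept as a parameter so that one constant serves every weight.\<close>

lemma (in bounded_bilinear)
  fixes f :: "'s \<Rightarrow> 'a" and g :: "'s \<Rightarrow> 'b"
  assumes f: "square_integrable M f" and g: "square_integrable M g"
    and meas: "(\<lambda>x. prod (f x) (g x)) \<in> borel_measurable M"
  shows integrable_norm_prod: "integrable M (\<lambda>x. norm (prod (f x) (g x)))"
    and integral_norm_prod_le: "0 < s \<Longrightarrow> 0 \<le> K \<Longrightarrow> (\<And>a b. norm (prod a b) \<le> norm a * norm b * K) \<Longrightarrow>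
      (\<integral>x. norm (prod (f x) (g x)) \<partial>M)
        \<le> K * (s * (\<integral>x. (norm (f x))\<^sup>2 \<partial>M) + (\<integral>x. (norm (g x))\<^sup>2 \<partial>M) / s)"
proof -
  have int: "integrable M (\<lambda>x. K * (s * (norm (f x))\<^sup>2 + (norm (g x))\<^sup>2 / s))" for K s
    using f g by (simp add: square_integrable_def)
  have bound: "norm (prod a b) \<le> K * (s * (norm a)\<^sup>2 + (norm b)\<^sup>2 / s)"
    if s: "0 < s" and K: "0 \<le> K" "\<And>a b. norm (prod a b) \<le> norm a * norm b * K" for K s a b
  proof -
    \<comment> \<open>This bounds twice the product; the product is nonnegative, so the factor 2 may
      be dropped before dividing by \<open>s\<close>.\<close>
    have "2 * (s * norm a) * norm b \<le> (s * norm a)\<^sup>2 + (norm b)\<^sup>2"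
      by (rule sum_squares_bound)
    moreover have "0 \<le> s * norm a * norm b"
      using s by simp
    ultimately have "s * norm a * norm b \<le> (s * norm a)\<^sup>2 + (norm b)\<^sup>2"
      by linarith
    with s have "norm a * norm b \<le> s * (norm a)\<^sup>2 + (norm b)\<^sup>2 / s"
      by (simp add: field_simps power2_eq_square)
    then have "norm a * norm b * K \<le> (s * (norm a)\<^sup>2 + (norm b)\<^sup>2 / s) * K"
      by (rule mult_right_mono) (rule K)
    with K(2)[of a b] show ?thesis
      by (simp add: mult.commute)
  qed
  obtain K0 where K0: "0 \<le> K0" "\<And>a b. norm (prod a b) \<le> norm a * norm b * K0"
    using nonneg_bounded by blast
  show int': "integrable M (\<lambda>x. norm (prod (f x) (g x)))"
  proof (rule Bochner_Integration.integrable_bound[OF int[of K0 1]])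
    show "AE x in M. norm (norm (prod (f x) (g x))) \<le> norm (K0 * (1 * (norm (f x))\<^sup>2 + (norm (g x))\<^sup>2 / 1))"
    proof (rule AE_I2)
      fix x
      show "norm (norm (prod (f x) (g x))) \<le> norm (K0 * (1 * (norm (f x))\<^sup>2 + (norm (g x))\<^sup>2 / 1))"
        using bound[OF zero_less_one K0, of "f x" "g x"] by (simp only: real_norm_def abs_norm_cancel)
    qed
  qed (rule measurable_compose[OF meas borel_measurable_norm])
  show "(\<integral>x. norm (prod (f x) (g x)) \<partial>M)
        \<le> K * (s * (\<integral>x. (norm (f x))\<^sup>2 \<partial>M) + (\<integral>x. (norm (g x))\<^sup>2 \<partial>M) / s)"
    if "0 < s" "0 \<le> K" "\<And>a b. norm (prod a b) \<le> norm a * norm b * K"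
  proof -
    have "(\<integral>x. norm (prod (f x) (g x)) \<partial>M)
        \<le> (\<integral>x. K * (s * (norm (f x))\<^sup>2 + (norm (g x))\<^sup>2 / s) \<partial>M)"
      by (rule integral_mono[OF int' int bound[OF that]])
    also have "\<dots> = K * (s * (\<integral>x. (norm (f x))\<^sup>2 \<partial>M) + (\<integral>x. (norm (g x))\<^sup>2 \<partial>M) / s)"
      using f g by (simp add: square_integrable_def)
    finally show ?thesis .
  qed
qed

text \<open>Second countability makes the Borel sets of the product space the product sigma-algebra,
  so continuity of \<open>prod\<close> suffices.\<close>

lemma bounded_bilinear_borel_measurable:
  fixes prod :: "'a::{real_normed_vector, second_countable_topology} \<Rightarrow>
      'b::{real_normed_vector, second_countable_topology} \<Rightarrow> 'c::real_normed_vector"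
  assumes "bounded_bilinear prod" "f \<in> borel_measurable M" "g \<in> borel_measurable M"
  shows "(\<lambda>x. prod (f x) (g x)) \<in> borel_measurable M"
  by (rule borel_measurable_continuous_Pair[OF assms(2,3)])
    (intro bounded_bilinear.continuous_on[OF assms(1)] continuous_intros)

lemma integrable_bounded_bilinear:
  fixes prod :: "'a::{real_normed_vector, second_countable_topology} \<Rightarrow>
      'b::{real_normed_vector, second_countable_topology} \<Rightarrow> 'c::{banach, second_countable_topology}"
  assumes "bounded_bilinear prod" "square_integrable M f" "square_integrable M g"
  shows "integrable M (\<lambda>x. prod (f x) (g x))"
proof -
  have "(\<lambda>x. prod (f x) (g x)) \<in> borel_measurable M"
    by (rule bounded_bilinear_borel_measurable[OF assms(1)])
      (use assms(2,3) in \<open>simp_all add: square_integrable_def\<close>)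
  then show ?thesis
    using bounded_bilinear.integrable_norm_prod[OF assms] by (auto intro: integrable_norm_cancel)
qed

text \<open>
  The weight \<open>s\<close> in \<open>a b \<le> s a\<^sup>2 + b\<^sup>2 / s\<close> is taken as the inverse of \<open>\<parallel>f\<^sub>n - f\<parallel> + 1 / (n + 1)\<close>, the
  second summand only keeping it finite.
\<close>

lemma tendsto_integral_bounded_bilinear:
  fixes prod :: "'a::{real_normed_vector, second_countable_topology} \<Rightarrow>
      'b::{real_normed_vector, second_countable_topology} \<Rightarrow> 'c::{banach, second_countable_topology}"
  assumes prod: "bounded_bilinear prod"
    and f: "\<And>n. square_integrable M (f n)" "square_integrable M f'" and g: "square_integrable M g"
    and lim: "(\<lambda>n. \<integral>\<^sup>+x. ennreal ((norm (f n x - f' x))\<^sup>2) \<partial>M) \<longlonglongrightarrow> 0"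
  shows "(\<lambda>n. \<integral>x. prod (f n x) (g x) \<partial>M) \<longlonglongrightarrow> (\<integral>x. prod (f' x) (g x) \<partial>M)"
proof -
  define D where "D n = (\<integral>x. (norm (f n x - f' x))\<^sup>2 \<partial>M)" for n
  define G where "G = (\<integral>x. (norm (g x))\<^sup>2 \<partial>M)"
  have G0: "0 \<le> G" by (simp add: G_def)
  have D0: "0 \<le> D n" for n by (simp add: D_def)
  note diff = square_integrable_diff_vector[OF f]
  \<comment> \<open>The differences are square integrable, so the extended integrals in
    \<open>lim\<close> are finite and the limit can be read in the reals.\<close>
  have "(\<integral>\<^sup>+x. ennreal ((norm (f n x - f' x))\<^sup>2) \<partial>M) = ennreal (D n)" for n
    unfolding D_def using diff[of n] by (intro nn_integral_eq_integral) (auto simp: square_integrable_def)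
  with lim have "(\<lambda>n. ennreal (D n)) \<longlonglongrightarrow> ennreal 0"
    by simp
  then have D: "D \<longlonglongrightarrow> 0"
    using D0 by (subst (asm) tendsto_ennreal_iff) auto
  obtain K where K: "0 \<le> K" "\<And>a b. norm (prod a b) \<le> norm a * norm b * K"
    using bounded_bilinear.nonneg_bounded[OF prod] by blast
  define r where "r n = sqrt (D n) + inverse (real (Suc n))" for n
  have r0: "0 < r n" for n
    unfolding r_def using D0[of n] by (intro add_nonneg_pos) auto
  have r: "r \<longlonglongrightarrow> sqrt 0 + 0"
    unfolding r_def by (intro tendsto_add tendsto_real_sqrt D LIMSEQ_inverse_real_of_nat)
  have bound: "norm ((\<integral>x. prod (f n x) (g x) \<partial>M) - (\<integral>x. prod (f' x) (g x) \<partial>M)) \<le> K * (r n + G * r n)" for n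
  proof -
    \<comment> \<open>Since \<open>D n\<close> is at most the square of \<open>r n\<close>, the
      weight \<open>inverse (r n)\<close> makes both terms of the bound at most constant multiples
      of \<open>r n\<close>, which tends to 0.\<close>
    have "D n = (sqrt (D n))\<^sup>2" using D0 by simp
    also have "\<dots> \<le> (r n)\<^sup>2"
      by (intro power_mono) (use D0 in \<open>auto simp: r_def\<close>)
    finally have weight: "inverse (r n) * D n \<le> r n"
      using r0[of n] by (simp add: field_simps power2_eq_square)
    have "(\<integral>x. prod (f n x) (g x) \<partial>M) - (\<integral>x. prod (f' x) (g x) \<partial>M) = (\<integral>x. prod (f n x - f' x) (g x) \<partial>M)"
      unfolding bounded_bilinear.diff_left[OF prod]
      by (rule Bochner_Integration.integral_diff[symmetric])
        (rule integrable_bounded_bilinear[OF prod f(1) g] integrable_bounded_bilinear[OF prod f(2) g])+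
    also have "norm \<dots> \<le> (\<integral>x. norm (prod (f n x - f' x) (g x)) \<partial>M)"
      by (rule integral_norm_bound)
    also have "\<dots> \<le> K * (inverse (r n) * D n + G / inverse (r n))"
      unfolding D_def G_def
      by (rule bounded_bilinear.integral_norm_prod_le[OF prod diff g
            borel_measurable_integrable[OF integrable_bounded_bilinear[OF prod diff g]] _ K])
        (use r0 in simp)
    also have "\<dots> \<le> K * (r n + G * r n)"
      using weight by (intro mult_left_mono K(1)) (simp add: divide_inverse)
    finally show ?thesis .
  qed
  have "(\<lambda>n. K * (r n + G * r n)) \<longlonglongrightarrow> K * ((sqrt 0 + 0) + G * (sqrt 0 + 0))"
    by (intro tendsto_mult tendsto_add tendsto_const r)
  then have "(\<lambda>n. K * (r n + G * r n)) \<longlonglongrightarrow> 0" by simp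
  from Lim_null_comparison[OF always_eventually[OF allI[OF bound]] this]
  have "(\<lambda>n. (\<integral>x. prod (f n x) (g x) \<partial>M) - (\<integral>x. prod (f' x) (g x) \<partial>M)) \<longlonglongrightarrow> 0" .
  then show ?thesis by (rule LIM_zero_cancel)
qed

section \<open>The complex Hilbert space structure\<close>

lemma cinner_add_left: "cinner (x + y) z = cinner x z + cinner y z"
  using cinner_add_right[of z x y] by (metis cinner_commute complex_cnj_add)

lemma cinner_scaleC_left: "cinner (scaleC c x) y = cnj c * cinner x y"
  using cinner_scaleC_right[of y c x] by (metis cinner_commute complex_cnj_mult)

text \<open>Rotating \<open>y\<close> by a phase makes the complex inner product real and
  nonnegative, which reduces the claim to the real Cauchy-Schwarz inequality.\<close>

lemma norm_cinner_le: "cmod (cinner x y) \<le> norm x * norm y"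
proof -
  define z where "z = cinner x y"
  \<comment> \<open>The phase is \<open>cnj (sgn z)\<close>; for \<open>z = 0\<close> it is 0, so
    its modulus is at most 1 in every case.\<close>
  have "cnj (sgn z) * z = of_real (cmod z)"
    by (cases "z = 0") (simp_all add: sgn_eq complex_norm_square[symmetric] power2_eq_square
        field_simps flip: of_real_mult)
  then have "cmod z = inner x (scaleC (cnj (sgn z)) y)"
    by (simp add: inner_fock_def cinner_scaleC_right z_def)
  also have "\<dots> \<le> norm x * norm (scaleC (cnj (sgn z)) y)"
    by (rule norm_cauchy_schwarz)
  also have "\<dots> \<le> norm x * norm y"
    by (intro mult_left_mono) (auto simp: norm_scaleC norm_sgn)
  finally show ?thesis by (simp add: z_def)
qed

text \<open>Conjugate linearity in the first argument is no obstacle, as bilinearity is over the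
  reals.\<close>

lemma bounded_bilinear_cinner: "bounded_bilinear cinner"
proof
  show "\<exists>K. \<forall>a b. norm (cinner a b) \<le> norm a * norm b * K"
    by (rule exI[of _ 1]) (simp add: norm_cinner_le)
qed (simp_all add: cinner_add_left cinner_add_right scaleR_fock_def cinner_scaleC_left
    cinner_scaleC_right scaleR_conv_of_real)

lemma bounded_bilinear_scaleC: "bounded_bilinear scaleC"
proof
  show "\<exists>K. \<forall>a b. norm (scaleC a b) \<le> norm a * norm b * K"
    by (rule exI[of _ 1]) (simp add: norm_scaleC)
qed (simp_all add: scaleC_simps scaleR_fock_def scaleR_conv_of_real mult.commute)

lemmas cinner_sum_left = bounded_bilinear.sum_left[OF bounded_bilinear_cinner]
lemmas cinner_sum_right = bounded_bilinear.sum_right[OF bounded_bilinear_cinner]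
lemmas cinner_diff_right = bounded_bilinear.diff_right[OF bounded_bilinear_cinner]
lemmas scaleC_diff_right = bounded_bilinear.diff_right[OF bounded_bilinear_scaleC]

lemma fock_operators_sum:
  assumes "T \<in> fock_operators"
  shows "blinfun_apply T (\<Sum>j\<in>J. scaleC (c j) (x j)) = (\<Sum>j\<in>J. scaleC (c j) (T (x j)))"
  using assms by (simp add: blinfun.sum_right fock_operators_def)

lemma fock_operators_op_scaleC: "T \<in> fock_operators \<Longrightarrow> op_scaleC c T \<in> fock_operators"
  by (simp add: fock_operators_def op_scaleC_apply scaleC_simps mult.commute)

lemma fock_operators_add: "S \<in> fock_operators \<Longrightarrow> T \<in> fock_operators \<Longrightarrow> S + T \<in> fock_operators"
  by (simp add: fock_operators_def blinfun.add_left scaleC_simps)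

lemma fock_operators_diff: "S \<in> fock_operators \<Longrightarrow> T \<in> fock_operators \<Longrightarrow> S - T \<in> fock_operators"
  by (simp add: fock_operators_def blinfun.diff_left scaleC_diff_right)

section \<open>The closed gradient and its adjoint\<close>

lemma exp_gradient_square_integrable:
  assumes "(\<psi>, u) \<in> exp_gradient"
  shows "square_integrable half_line u"
proof -
  from assms obtain m :: nat and c k where k: "\<forall>j<m. square_integrable half_line (k j)"
    and u: "u = (\<lambda>t. \<Sum>j<m. scaleC (c j * k j t) (exp_vec (k j)))"
    by (auto simp: exp_gradient_def)
  show ?thesis unfolding u
    by (intro square_integrable_sum_vector square_integrable_cmult
        square_integrable_bounded_linear[OF bounded_bilinear.bounded_linear_left[OF bounded_bilinear_scaleC]])
      (use k in auto)
qed

lemma exp_gradient_subset_malliavin_gradient: "exp_gradient \<subseteq> malliavin_gradient"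
proof (clarify)
  fix \<psi> u assume "(\<psi>, u) \<in> exp_gradient"
  then show "(\<psi>, u) \<in> malliavin_gradient"
    unfolding malliavin_gradient_def
    by (auto intro!: exI[of _ "\<lambda>_. \<psi>"] exI[of _ "\<lambda>_. u"] exp_gradient_square_integrable)
qed

text \<open>Reduces the adjoint relation to single exponential vectors, whose gradient is
  \<open>l t\<close> times \<open>exp_vec l\<close>; the conjugate comes from the first slot of
  \<open>cinner\<close>.\<close>

lemma skorohod_divergenceI:
  assumes v: "square_integrable half_line v"
    and exp: "\<And>l. square_integrable half_line l \<Longrightarrow>
      (\<integral>t. cnj (l t) * cinner (exp_vec l) (v t) \<partial>half_line) = cinner (exp_vec l) \<phi>"
  shows "(v, \<phi>) \<in> skorohod_divergence"
proof -
  have grad: "(\<integral>t. cinner (u t) (v t) \<partial>half_line) = cinner \<psi> \<phi>" if "(\<psi>, u) \<in> exp_gradient" for \<psi> u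
  proof -
    from that obtain m :: nat and c l where l: "\<And>j. j < m \<Longrightarrow> square_integrable half_line (l j)"
      and \<psi>: "\<psi> = (\<Sum>j<m. scaleC (c j) (exp_vec (l j)))"
      and u: "u = (\<lambda>t. \<Sum>j<m. scaleC (c j * l j t) (exp_vec (l j)))"
      by (auto simp: exp_gradient_def)
    \<comment> \<open>Each term is a product of two square-integrable functions, so the integral may
      be exchanged with the finite sum.\<close>
    have "integrable half_line (\<lambda>t. cnj (l j t) * cinner (exp_vec (l j)) (v t))" if "j < m" for j
      by (intro integrable_cnj_mult l that v
          square_integrable_bounded_linear[OF bounded_bilinear.bounded_linear_right[OF bounded_bilinear_cinner]])
    then have "(\<integral>t. cinner (u t) (v t) \<partial>half_line) =
        (\<Sum>j<m. cnj (c j) * (\<integral>t. cnj (l j t) * cinner (exp_vec (l j)) (v t) \<partial>half_line))"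
      by (simp add: u cinner_sum_left cinner_scaleC_left mult.assoc)
    also have "\<dots> = cinner \<psi> \<phi>"
      by (simp add: \<psi> cinner_sum_left cinner_scaleC_left exp l)
    finally show ?thesis .
  qed
  have "(\<integral>t. cinner (u t) (v t) \<partial>half_line) = cinner \<psi> \<phi>" if "(\<psi>, u) \<in> malliavin_gradient" for \<psi> u
  proof -
    from that obtain \<psi>s us where u: "square_integrable half_line u"
      and *: "\<And>n. (\<psi>s n, us n) \<in> exp_gradient" "\<psi>s \<longlonglongrightarrow> \<psi>"
      "(\<lambda>n. \<integral>\<^sup>+t. ennreal ((norm (us n t - u t))\<^sup>2) \<partial>half_line) \<longlonglongrightarrow> 0"
      by (auto simp: malliavin_gradient_def)
    \<comment> \<open>By \<open>grad\<close> the two sequences below coincide term by term, so their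
      limits agree.\<close>
    have "(\<lambda>n. \<integral>t. cinner (us n t) (v t) \<partial>half_line) \<longlonglongrightarrow> (\<integral>t. cinner (u t) (v t) \<partial>half_line)"
      by (intro tendsto_integral_bounded_bilinear[OF bounded_bilinear_cinner] u v *
          exp_gradient_square_integrable[OF *(1)])
    moreover have "(\<lambda>n. cinner (\<psi>s n) \<phi>) \<longlonglongrightarrow> cinner \<psi> \<phi>"
      by (intro bounded_bilinear.tendsto[OF bounded_bilinear_cinner] * tendsto_const)
    ultimately show ?thesis
      using LIMSEQ_unique by (simp add: grad[OF *(1)])
  qed
  with v show ?thesis by (auto simp: skorohod_divergence_def)
qed

section \<open>The Hitsuda--Skorohod integral\<close>

lemma square_integrable_apply:
  "square_integrable M F \<Longrightarrow> square_integrable M (\<lambda>t. blinfun_apply (F t) x)"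
  by (rule square_integrable_bounded_linear[OF blinfun.bounded_linear_left])

text \<open>The bounded operators are not norm separable, so sums are formed after evaluation at
  \<open>x\<close>, in the separable Fock space, where they stay Borel measurable.\<close>

lemma has_divergence_square_integrable:
  assumes "has_divergence (X1, X2) M"
  shows "square_integrable half_line (\<lambda>t. (X2 t + op_scaleC \<i> (X1 t)) x)"
    and "square_integrable half_line (\<lambda>t. (X2 t - op_scaleC \<i> (X1 t)) x)"
proof -
  have "square_integrable half_line X1" "square_integrable half_line X2"
    using assms by (auto simp: has_divergence_def square_integrable_process_def)
  from this[THEN square_integrable_apply, of x]
  have "square_integrable half_line (\<lambda>t. scaleC \<i> (X1 t x))" "square_integrable half_line (\<lambda>t. X2 t x)"
    by (auto intro: square_integrable_bounded_linear[OF bounded_linear_scaleC])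
  then show "square_integrable half_line (\<lambda>t. (X2 t + op_scaleC \<i> (X1 t)) x)"
    "square_integrable half_line (\<lambda>t. (X2 t - op_scaleC \<i> (X1 t)) x)"
    by (simp_all add: blinfun.add_left blinfun.diff_left op_scaleC_apply
        square_integrable_add_vector square_integrable_diff_vector)
qed

lemma has_divergence_exp_vec:
  assumes X: "has_divergence (X1, X2) M"
    and l: "square_integrable half_line l" and k: "square_integrable half_line k"
  shows "(\<integral>t. cnj (l t) * cinner (exp_vec l) ((X2 t - op_scaleC \<i> (X1 t)) (exp_vec k)) \<partial>half_line) =
    cinner (exp_vec l) (M (exp_vec k) - (\<integral>t. scaleC (k t) ((X2 t + op_scaleC \<i> (X1 t)) (exp_vec k)) \<partial>half_line))"
    (is "(\<integral>t. ?m t \<partial>half_line) = cinner ?l (M ?k - (\<integral>t. ?p t \<partial>half_line))")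
proof -
  \<comment> \<open>The creation and annihilation parts are shown integrable separately: only then
    may the integral defining the divergence be split.\<close>
  have p: "integrable half_line ?p"
    by (rule integrable_bounded_bilinear[OF bounded_bilinear_scaleC k has_divergence_square_integrable(1)[OF X]])
  note lin = bounded_bilinear.bounded_linear_right[OF bounded_bilinear_cinner, of ?l]
  have m: "integrable half_line ?m"
    by (intro integrable_cnj_mult l square_integrable_bounded_linear[OF lin]
        has_divergence_square_integrable(2)[OF X])
  have "cinner ?l (M ?k) = (\<integral>t. \<i> * (k t - cnj (l t)) * cinner ?l (X1 t ?k)
      + (cnj (l t) + k t) * cinner ?l (X2 t ?k) \<partial>half_line)"
    using X l k by (simp add: has_divergence_def)
  \<comment> \<open>Pointwise regrouping: the coefficient of \<open>cnj (l t)\<close> is X2 - i X1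
    and that of \<open>k t\<close> is X2 + i X1.\<close>
  also have "\<dots> = (\<integral>t. ?m t + cinner ?l (?p t) \<partial>half_line)"
    by (simp add: blinfun.add_left blinfun.diff_left op_scaleC_apply cinner_add_right cinner_diff_right
        cinner_scaleC_right scaleC_simps algebra_simps)
  \<comment> \<open>Pairing with a fixed vector is bounded linear, so it commutes with the Bochner
    integral of \<open>?p\<close>.\<close>
  also have "\<dots> = (\<integral>t. ?m t \<partial>half_line) + cinner ?l (\<integral>t. ?p t \<partial>half_line)"
    using m integrable_bounded_linear[OF lin p] integral_bounded_linear[OF lin p] by simp
  finally show ?thesis by (simp add: cinner_diff_right)
qed

theorem proposition6p7p5:
  fixes X1 X2 :: "real \<Rightarrow> fock \<Rightarrow>\<^sub>L fock" and M :: "fock \<Rightarrow>\<^sub>L fock" and \<psi> :: fock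
  assumes "has_divergence (X1, X2) M"
    and "\<psi> \<in> exp_span"
  shows "\<exists>c a. has_creation_integral (\<lambda>t. X2 t - op_scaleC \<i> (X1 t)) \<psi> c \<and>
               has_annihilation_integral (\<lambda>t. X2 t + op_scaleC \<i> (X1 t)) \<psi> a \<and>
               M \<psi> = c + a"
proof -
  note X = assms(1)
  define Fp where "Fp t = X2 t + op_scaleC \<i> (X1 t)" for t
  define Fm where "Fm t = X2 t - op_scaleC \<i> (X1 t)" for t
  \<comment> \<open>Complex linearity is available for nonnegative times only, hence the appeals to
    \<open>space\<close> in the pointwise identities below.\<close>
  have M: "M \<in> fock_operators" and ops: "\<And>t. 0 \<le> t \<Longrightarrow> Fp t \<in> fock_operators"
      "\<And>t. 0 \<le> t \<Longrightarrow> Fm t \<in> fock_operators"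
    using X by (auto simp: Fp_def Fm_def has_divergence_def square_integrable_process_def
        intro!: fock_operators_add fock_operators_diff fock_operators_op_scaleC)
  have space: "space half_line = {0..}"
    by (simp add: half_line_def space_restrict_space)
  from assms(2) obtain m :: nat and c k where k: "\<And>j. j < m \<Longrightarrow> square_integrable half_line (k j)"
    and \<psi>: "\<psi> = (\<Sum>j<m. scaleC (c j) (exp_vec (k j)))"
    by (auto simp: exp_span_def)
  \<comment> \<open>\<open>u\<close> is the gradient of \<psi> read off from the chosen combination,
    and \<open>a\<close> is the corresponding combination of Bochner integrals.\<close>
  define u where "u t = (\<Sum>j<m. scaleC (c j * k j t) (exp_vec (k j)))" for t
  define b where "b j = (\<integral>t. scaleC (k j t) (Fp t (exp_vec (k j))) \<partial>half_line)" for j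
  define a where "a = (\<Sum>j<m. scaleC (c j) (b j))"
  have b: "has_bochner_integral half_line (\<lambda>t. scaleC (k j t) (Fp t (exp_vec (k j)))) (b j)" if "j < m" for j
    unfolding b_def Fp_def
    by (intro has_bochner_integral_integrable integrable_bounded_bilinear[OF bounded_bilinear_scaleC]
        k that has_divergence_square_integrable(1)[OF X])
  have "has_annihilation_integral Fp \<psi> a"
    unfolding has_annihilation_integral_def
  proof (intro exI conjI)
    have "(\<psi>, u) \<in> exp_gradient"
      using k by (auto simp: exp_gradient_def \<psi> u_def[abs_def])
    then show "(\<psi>, u) \<in> malliavin_gradient"
      using exp_gradient_subset_malliavin_gradient by blast
    have "has_bochner_integral half_line (\<lambda>t. \<Sum>j<m. scaleC (c j) (scaleC (k j t) (Fp t (exp_vec (k j))))) a"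
      unfolding a_def
      by (intro has_bochner_integral_sum has_bochner_integral_bounded_linear[OF bounded_linear_scaleC] b) auto
    \<comment> \<open>Complex linearity of \<open>Fp t\<close> moves the scalars
      \<open>c j * k j t\<close> outside the operator.\<close>
    then show "has_bochner_integral half_line (\<lambda>t. Fp t (u t)) a"
      by (rule has_bochner_integral_cong[THEN iffD1, rotated -1])
        (auto simp: space u_def fock_operators_sum[OF ops(1)] scaleC_simps)
  qed
  \<comment> \<open>The creation value is taken to be the remainder, so the decomposition of
    \<open>M \<psi>\<close> is automatic and the work lies in the adjoint relation.\<close>
  moreover have "has_creation_integral Fm \<psi> (M \<psi> - a)"
    unfolding has_creation_integral_def
  proof (rule skorohod_divergenceI)
    show "square_integrable half_line (\<lambda>t. Fm t \<psi>)"
      unfolding Fm_def by (rule has_divergence_square_integrable(2)[OF X])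
    fix l :: "real \<Rightarrow> complex" assume l: "square_integrable half_line l"
    have int: "integrable half_line (\<lambda>t. cnj (l t) * cinner (exp_vec l) (Fm t (exp_vec (k j))))" for j
      unfolding Fm_def
      by (intro integrable_cnj_mult l has_divergence_square_integrable(2)[OF X]
          square_integrable_bounded_linear[OF bounded_bilinear.bounded_linear_right[OF bounded_bilinear_cinner]])
    have "(\<integral>t. cnj (l t) * cinner (exp_vec l) (Fm t \<psi>) \<partial>half_line) =
        (\<integral>t. (\<Sum>j<m. c j * (cnj (l t) * cinner (exp_vec l) (Fm t (exp_vec (k j))))) \<partial>half_line)"
      by (intro Bochner_Integration.integral_cong refl)
        (simp add: space \<psi> fock_operators_sum[OF ops(2)] cinner_sum_right cinner_scaleC_right
          sum_distrib_left mult_ac)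
    also have "\<dots> = (\<Sum>j<m. c j * (\<integral>t. cnj (l t) * cinner (exp_vec l) (Fm t (exp_vec (k j))) \<partial>half_line))"
      using int by simp
    also have "\<dots> = (\<Sum>j<m. c j * cinner (exp_vec l) (M (exp_vec (k j)) - b j))"
      unfolding Fm_def b_def Fp_def using has_divergence_exp_vec[OF X l k] by simp
    also have "\<dots> = cinner (exp_vec l) (M \<psi> - a)"
      by (simp add: \<psi> a_def fock_operators_sum[OF M] cinner_diff_right cinner_sum_right
          cinner_scaleC_right right_diff_distrib sum_subtractf)
    finally show "(\<integral>t. cnj (l t) * cinner (exp_vec l) (Fm t \<psi>) \<partial>half_line) = cinner (exp_vec l) (M \<psi> - a)" .
  qed
  ultimately show ?thesis
    unfolding Fp_def Fm_def by (intro exI[of _ "M \<psi> - a"] exI[of _ a]) simp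
qed

end
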